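(* Let $(T,F)$ be a rooted tree with a source $\ast$ over $(Q,\rho)$ and $M:=M(T,F)$. Suppose $n_1,\dots,n_k$ is the list of all the vertices of $T$ such that $\mathsf p(n_j)=\ast$, and that $M_j:=M(\mathsf{Br}(n_j),F|_{\mathsf{Br}(n_j)})$ is indecomposable for each $j$. Then the following are equivalent. (a) The module $M$ is decomposable. (b) There are distinct $i,j\in\{1,\dots,k\}$ satisfying $F(a_{n_i})=F(a_{n_j})$, and a quiver morphism $\iota:\mathsf{Br}(n_i)\to\mathsf{Br}(n_j)$ satisfying $\iota(n_i)=n_j$ and $F|_{\mathsf{Br}(n_j)}\circ\iota=F|_{\mathsf{Br}(n_i)}$.
   Context: Fix a field $\mathcal K$ with $\mathrm{char}(\mathcal K)\neq 2$. Let $Q=(Q_0,Q_1,\varsigma,\varepsilon)$ be a quiver and $\rho$ a set of paths in $Q$ of length at least $2$ that bounds the length of the paths, not lying in the ideal $\langle\rho\rangle$, passing through any vertex. Put $\Lambda:=\mathcal KQ/\langle\rho\rangle$. Finite-dimensional $\Lambda$-modules are identified with finite-dimensional $\mathcal K$-representations of $(Q,\rho)$. A tree is a finite quiver $T=(T_0,T_1,s,t)$ whose underlying undirected graph is connected without cycles. Here rooted trees have a unique source $\ast$ (the root). For $n\in T_0\setminus\{\ast\}$ there is a unique arrow with target $n$, denoted $a_n$; its source is the parent $\mathsf p(n)$. For $n\in T_0$, the branch $\mathsf{Br}(n)$ is the subquiver of $T$ with vertices all $n'\in T_0$ admitting a (possibly zero-length) path from $n$ to $n'$, and arrows $a_m$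 for $m\in\mathsf{Br}(n)_0\setminus\{n\}$; it is a rooted tree with source $n$. A quiver morphism is a pair of maps (on vertices and on arrows) commuting with sources and targets. A quiver morphism $F:T\to Q$ is bound, written $F:T\to(Q,\rho)$, if there is no path $p$ in $T$ with $F(p)\in\langle\rho\rangle$; then $(T,F)$ is a tree over $(Q,\rho)$. The rooted tree module $M(T,F)$ is the $\Lambda$-module with $\mathcal K$-basis $\{v_n\mid n\in T_0\}$, with $v_n$ at the vertex $F(n)$, where $\gamma\in Q_1$ acts by $\gamma\cdot v_n=\sum_{a\in T_1,\ s(a)=n,\ F(a)=\gamma}v_{t(a)}$. *)

theory Defs
  imports
    "Graph_Theory.Graph_Theory"
    "HOL-Library.Poly_Mapping"
    "HOL-Computational_Algebra.Computational_Algebra"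
begin

text \<open>
  A quiver is a \<^typ>\<open>('v, 'e) pre_digraph\<close> satisfying \<^const>\<open>wf_digraph\<close>: loops, parallel arrows
  and infinitely many vertices or arrows are allowed.
\<close>

section \<open>Path algebras and monomial bounds\<close>

text \<open>A path is given by its starting vertex and its list of arrows, in the order of traversal;
  the path \<open>(u, [])\<close> is the trivial path at \<open>u\<close>.\<close>

type_synonym ('v, 'e) qpath = "'v \<times> 'e list"

definition qpaths :: "('v, 'e) pre_digraph \<Rightarrow> ('v, 'e) qpath set" where
  "qpaths Q = {(u, p). \<exists>v. pre_digraph.awalk Q u p v}"

definition path_target :: "('v, 'e) pre_digraph \<Rightarrow> ('v, 'e) qpath \<Rightarrow> 'v" where
  "path_target Q p = last (pre_digraph.awalk_verts Q (fst p) (snd p))"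

definition path_algebra :: "('v, 'e) pre_digraph \<Rightarrow> (('v, 'e) qpath \<Rightarrow>\<^sub>0 'k::field) set" where
  "path_algebra Q = {x. Poly_Mapping.keys x \<subseteq> qpaths Q}"

text \<open>Modules are left modules, so that in a product the right factor is traversed first.\<close>

definition path_mult :: "('v, 'e) pre_digraph \<Rightarrow> (('v, 'e) qpath \<Rightarrow>\<^sub>0 'k::field) \<Rightarrow>
    (('v, 'e) qpath \<Rightarrow>\<^sub>0 'k) \<Rightarrow> (('v, 'e) qpath \<Rightarrow>\<^sub>0 'k)" where
  "path_mult Q x y =
    (\<Sum>p\<in>Poly_Mapping.keys x. \<Sum>q\<in>Poly_Mapping.keys y.
      if path_target Q q = fst p
      then Poly_Mapping.single (fst q, snd q @ snd p) (Poly_Mapping.lookup x p * Poly_Mapping.lookup y q)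
      else 0)"

definition pm_scale :: "'k::field \<Rightarrow> ('x \<Rightarrow>\<^sub>0 'k) \<Rightarrow> ('x \<Rightarrow>\<^sub>0 'k)" where
  "pm_scale c x = Poly_Mapping.map ((*) c) x"

lemma lookup_pm_scale [simp]:
  "Poly_Mapping.lookup (pm_scale c x) i = c * Poly_Mapping.lookup x i"
  by (simp add: pm_scale_def Poly_Mapping.map.rep_eq when_def)

interpretation pm: vector_space "pm_scale :: 'k::field \<Rightarrow> ('x \<Rightarrow>\<^sub>0 'k) \<Rightarrow> ('x \<Rightarrow>\<^sub>0 'k)"
  by unfold_locales (auto intro!: poly_mapping_eqI simp: lookup_add algebra_simps)

text \<open>Scalars are mentioned explicitly, as the path algebra has no unit if \<open>Q\<close> has infinitely
  many vertices.\<close>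

definition two_sided_ideal :: "('v, 'e) pre_digraph \<Rightarrow> (('v, 'e) qpath \<Rightarrow>\<^sub>0 'k::field) set \<Rightarrow> bool" where
  "two_sided_ideal Q I \<longleftrightarrow>
    I \<subseteq> path_algebra Q \<and> pm.subspace I \<and>
    (\<forall>x\<in>I. \<forall>y\<in>path_algebra Q. path_mult Q x y \<in> I \<and> path_mult Q y x \<in> I)"

definition ideal_of_paths :: "('v, 'e) pre_digraph \<Rightarrow> ('v, 'e) qpath set \<Rightarrow>
    (('v, 'e) qpath \<Rightarrow>\<^sub>0 'k::field) set" where
  "ideal_of_paths Q \<rho> = \<Inter>{I. two_sided_ideal Q I \<and> (\<forall>p\<in>\<rho>. Poly_Mapping.single p 1 \<in> I)}"

text \<open>The coefficient field is passed as a type argument.\<close>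

definition path_in_ideal :: "'k::field itself \<Rightarrow> ('v, 'e) pre_digraph \<Rightarrow> ('v, 'e) qpath set \<Rightarrow>
    ('v, 'e) qpath \<Rightarrow> bool" where
  "path_in_ideal K Q \<rho> p \<longleftrightarrow>
    (Poly_Mapping.single p 1 :: ('v, 'e) qpath \<Rightarrow>\<^sub>0 'k) \<in> ideal_of_paths Q \<rho>"

definition bound_quiver :: "'k::field itself \<Rightarrow> ('v, 'e) pre_digraph \<Rightarrow> ('v, 'e) qpath set \<Rightarrow> bool" where
  "bound_quiver K Q \<rho> \<longleftrightarrow>
    wf_digraph Q \<and>
    \<rho> \<subseteq> qpaths Q \<and>
    (\<forall>p\<in>\<rho>. 2 \<le> length (snd p)) \<and>
    (\<forall>v\<in>verts Q. \<exists>N. \<forall>p\<in>qpaths Q.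
      v \<in> set (pre_digraph.awalk_verts Q (fst p) (snd p)) \<and> \<not> path_in_ideal K Q \<rho> p
        \<longrightarrow> length (snd p) \<le> N)"

section \<open>Representations\<close>

record ('v, 'e, 'x) quiver_rep =
  rep_space :: "'v \<Rightarrow> 'x set"
  rep_map :: "'e \<Rightarrow> 'x \<Rightarrow> 'x"

text \<open>Finite-dimensional representations of \<open>(Q, \<rho>)\<close>, that is, finite-dimensional modules over
  \<open>KQ / \<langle>\<rho>\<rangle>\<close>. The spaces at the various vertices are subspaces of one ambient vector space, but
  are not assumed to be independent there: the module is their external direct sum.\<close>

definition representation :: "('k::field \<Rightarrow> 'x::ab_group_add \<Rightarrow> 'x) \<Rightarrow> ('v, 'e) pre_digraph \<Rightarrow>
    ('v, 'e) qpath set \<Rightarrow> ('v, 'e, 'x) quiver_rep \<Rightarrow> bool" where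
  "representation scale Q \<rho> M \<longleftrightarrow>
    (\<forall>q\<in>verts Q. module.subspace scale (rep_space M q) \<and>
       (\<exists>B. finite B \<and> module.span scale B = rep_space M q)) \<and>
    finite {q \<in> verts Q. rep_space M q \<noteq> {0}} \<and>
    (\<forall>a\<in>arcs Q. \<forall>x\<in>rep_space M (tail Q a).
       rep_map M a x \<in> rep_space M (head Q a) \<and>
       (\<forall>y\<in>rep_space M (tail Q a). rep_map M a (x + y) = rep_map M a x + rep_map M a y) \<and>
       (\<forall>c. rep_map M a (scale c x) = scale c (rep_map M a x))) \<and>
    (\<forall>p\<in>\<rho>. \<forall>x\<in>rep_space M (fst p). fold (rep_map M) (snd p) x = 0)"

definition subrepresentation :: "('k::field \<Rightarrow> 'x::ab_group_add \<Rightarrow> 'x) \<Rightarrow> ('v, 'e) pre_digraph \<Rightarrow>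
    ('v, 'e, 'x) quiver_rep \<Rightarrow> ('v \<Rightarrow> 'x set) \<Rightarrow> bool" where
  "subrepresentation scale Q M U \<longleftrightarrow>
    (\<forall>q\<in>verts Q. module.subspace scale (U q) \<and> U q \<subseteq> rep_space M q) \<and>
    (\<forall>a\<in>arcs Q. rep_map M a ` U (tail Q a) \<subseteq> U (head Q a))"

definition nonzero_on :: "('v, 'e) pre_digraph \<Rightarrow> ('v \<Rightarrow> 'x::ab_group_add set) \<Rightarrow> bool" where
  "nonzero_on Q U \<longleftrightarrow> (\<exists>q\<in>verts Q. U q \<noteq> {0})"

definition decomposable :: "('k::field \<Rightarrow> 'x::ab_group_add \<Rightarrow> 'x) \<Rightarrow> ('v, 'e) pre_digraph \<Rightarrow>
    ('v, 'e, 'x) quiver_rep \<Rightarrow> bool" where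
  "decomposable scale Q M \<longleftrightarrow>
    (\<exists>U W. subrepresentation scale Q M U \<and> subrepresentation scale Q M W \<and>
      nonzero_on Q U \<and> nonzero_on Q W \<and>
      (\<forall>q\<in>verts Q. rep_space M q = {u + w |u w. u \<in> U q \<and> w \<in> W q} \<and> U q \<inter> W q = {0}))"

definition indecomposable :: "('k::field \<Rightarrow> 'x::ab_group_add \<Rightarrow> 'x) \<Rightarrow> ('v, 'e) pre_digraph \<Rightarrow>
    ('v, 'e, 'x) quiver_rep \<Rightarrow> bool" where
  "indecomposable scale Q M \<longleftrightarrow> nonzero_on Q (rep_space M) \<and> \<not> decomposable scale Q M"

section \<open>Rooted trees and their branches\<close>

text \<open>Every arrow may be traversed in both directions; the flag \<open>True\<close> stands for traversal against
  its orientation. Requiring distinct arrows in a cycle excludes going back and forth along one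
  arrow, while a loop or a pair of parallel arrows does form a cycle. (The constants \<^const>\<open>forest\<close>
  and \<^const>\<open>tree\<close> of the library refer to oriented cycles.)\<close>

definition underlying :: "('n, 'b) pre_digraph \<Rightarrow> ('n, 'b \<times> bool) pre_digraph" where
  "underlying T = \<lparr>verts = verts T, arcs = arcs T \<times> UNIV,
     tail = (\<lambda>(a, b). if b then head T a else tail T a),
     head = (\<lambda>(a, b). if b then tail T a else head T a)\<rparr>"

definition tree_quiver :: "('n, 'b) pre_digraph \<Rightarrow> bool" where
  "tree_quiver T \<longleftrightarrow>
    fin_digraph T \<and> connected T \<and>
    \<not> (\<exists>p. pre_digraph.cycle (underlying T) p \<and> distinct (map fst p))"

definition rooted_tree :: "('n, 'b) pre_digraph \<Rightarrow> 'n \<Rightarrow> bool" where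
  "rooted_tree T r \<longleftrightarrow> tree_quiver T \<and> {n \<in> verts T. in_arcs T n = {}} = {r}"

definition in_arrow :: "('n, 'b) pre_digraph \<Rightarrow> 'n \<Rightarrow> 'b" where
  "in_arrow T n = (THE a. a \<in> arcs T \<and> head T a = n)"

definition parent :: "('n, 'b) pre_digraph \<Rightarrow> 'n \<Rightarrow> 'n" where
  "parent T n = tail T (in_arrow T n)"

definition branch :: "('n, 'b) pre_digraph \<Rightarrow> 'n \<Rightarrow> ('n, 'b) pre_digraph" where
  "branch T n = \<lparr>verts = {m. n \<rightarrow>\<^sup>*\<^bsub>T\<^esub> m}, arcs = in_arrow T ` ({m. n \<rightarrow>\<^sup>*\<^bsub>T\<^esub> m} - {n}),
     tail = tail T, head = head T\<rparr>"

section \<open>Quiver morphisms and tree modules\<close>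

text \<open>A morphism is a pair of total functions, of which only the values on vertices and arrows of
  the source quiver matter. In particular the restriction of a morphism to a subquiver is
  represented by the same pair.\<close>

type_synonym ('n, 'b, 'v, 'e) quiver_map = "('n \<Rightarrow> 'v) \<times> ('b \<Rightarrow> 'e)"

definition quiver_morphism :: "('n, 'b) pre_digraph \<Rightarrow> ('v, 'e) pre_digraph \<Rightarrow>
    ('n, 'b, 'v, 'e) quiver_map \<Rightarrow> bool" where
  "quiver_morphism T Q F \<longleftrightarrow>
    fst F ` verts T \<subseteq> verts Q \<and> snd F ` arcs T \<subseteq> arcs Q \<and>
    (\<forall>a\<in>arcs T. fst F (tail T a) = tail Q (snd F a) \<and> fst F (head T a) = head Q (snd F a))"

definition map_path :: "('n, 'b, 'v, 'e) quiver_map \<Rightarrow> ('n, 'b) qpath \<Rightarrow> ('v, 'e) qpath" where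
  "map_path F p = (fst F (fst p), map (snd F) (snd p))"

definition bound_morphism :: "'k::field itself \<Rightarrow> ('n, 'b) pre_digraph \<Rightarrow> ('v, 'e) pre_digraph \<Rightarrow>
    ('v, 'e) qpath set \<Rightarrow> ('n, 'b, 'v, 'e) quiver_map \<Rightarrow> bool" where
  "bound_morphism K T Q \<rho> F \<longleftrightarrow>
    quiver_morphism T Q F \<and> \<not> (\<exists>p\<in>qpaths T. path_in_ideal K Q \<rho> (map_path F p))"

abbreviation basis_vec :: "'n \<Rightarrow> ('n \<Rightarrow>\<^sub>0 'k::field)" where
  "basis_vec n \<equiv> Poly_Mapping.single n 1"

definition tree_module :: "('n, 'b) pre_digraph \<Rightarrow> ('n, 'b, 'v, 'e) quiver_map \<Rightarrow>
    ('v, 'e, 'n \<Rightarrow>\<^sub>0 'k::field) quiver_rep" where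
  "tree_module T F = \<lparr>
     rep_space = (\<lambda>q. pm.span (basis_vec ` {n \<in> verts T. fst F n = q})),
     rep_map = (\<lambda>g x. \<Sum>n\<in>verts T. pm_scale (Poly_Mapping.lookup x n)
       (\<Sum>a\<in>{a \<in> arcs T. tail T a = n \<and> snd F a = g}. basis_vec (head T a)))\<rparr>"

text \<open>Tree modules of bound morphisms are indeed finite-dimensional representations of
  \<open>(Q, \<rho>)\<close>.\<close>

lemma rep_space_tree_module:
  fixes T :: "('a, 'b) pre_digraph" and F :: "('a, 'b, 'v, 'e) quiver_map"
  assumes "finite (verts T)"
  shows "rep_space (tree_module T F :: ('v, 'e, 'a \<Rightarrow>\<^sub>0 'd::field) quiver_rep) q =
    {x. Poly_Mapping.keys x \<subseteq> {n \<in> verts T. fst F n = q}}" (is "?L = ?R")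
proof
  have "pm.subspace ?R"
    unfolding pm.subspace_def
  proof (intro conjI ballI allI)
    fix x y :: "'a \<Rightarrow>\<^sub>0 'd" and c :: 'd
    assume "x \<in> ?R" "y \<in> ?R"
    then show "x + y \<in> ?R" using keys_add[of x y] by blast
  qed (auto simp: in_keys_iff subset_iff)
  then show "?L \<subseteq> ?R"
    unfolding tree_module_def quiver_rep.simps
    by (rule pm.span_minimal[rotated]) (auto split: if_splits)
  show "?R \<subseteq> ?L"
  proof
    fix x assume x: "x \<in> ?R"
    have "x = (\<Sum>n\<in>Poly_Mapping.keys x. pm_scale (Poly_Mapping.lookup x n) (basis_vec n))"
      by (rule poly_mapping_eqI)
        (simp add: lookup_sum lookup_single when_def in_keys_iff if_distrib cong: if_cong)
    also have "\<dots> \<in> ?L"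
      using x unfolding tree_module_def quiver_rep.simps
      by (intro pm.span_sum pm.span_scale pm.span_base) auto
    finally show "x \<in> ?L" .
  qed
qed

lemma keys_rep_map_tree_module:
  fixes x :: "'n \<Rightarrow>\<^sub>0 'c::field"
  assumes "m \<in> Poly_Mapping.keys (rep_map (tree_module T F) g x)"
  obtains a where "a \<in> arcs T" "tail T a \<in> Poly_Mapping.keys x" "snd F a = g" "head T a = m"
proof -
  have "(\<Sum>n\<in>verts T. Poly_Mapping.lookup x n *
      (\<Sum>a\<in>{a \<in> arcs T. tail T a = n \<and> snd F a = g}. Poly_Mapping.lookup (basis_vec (head T a)) m)) \<noteq> 0"
    using assms by (simp add: tree_module_def in_keys_iff lookup_sum)
  then obtain n where n: "Poly_Mapping.lookup x n *
      (\<Sum>a\<in>{a \<in> arcs T. tail T a = n \<and> snd F a = g}. Poly_Mapping.lookup (basis_vec (head T a)) m) \<noteq> 0"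
    by (meson sum.not_neutral_contains_not_neutral)
  then obtain a where "a \<in> {a \<in> arcs T. tail T a = n \<and> snd F a = g}"
      "Poly_Mapping.lookup (basis_vec (head T a) :: _ \<Rightarrow>\<^sub>0 'c) m \<noteq> 0"
    by (metis (mono_tags, lifting) mult_zero_right sum.neutral)
  with n show thesis
    by (intro that[of a]) (auto simp: in_keys_iff lookup_single when_def split: if_splits)
qed

lemma keys_path_tree_module:
  assumes "wf_digraph T" "Poly_Mapping.keys x \<subseteq> verts T"
    and "m \<in> Poly_Mapping.keys (fold (rep_map (tree_module T F)) p x)"
  obtains n w where "n \<in> Poly_Mapping.keys x" "pre_digraph.awalk T n w m" "map (snd F) w = p"
  using assms(2,3)
proof (induction p arbitrary: x thesis)
  case Nil
  then show ?case
    using Nil(1)[of m "[]"] by (auto simp: pre_digraph.awalk_def pre_digraph.cas.simps)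
next
  case (Cons g p)
  let ?y = "rep_map (tree_module T F) g x"
  have y: "Poly_Mapping.keys ?y \<subseteq> verts T"
    by (auto elim!: keys_rep_map_tree_module simp: wf_digraph.head_in_verts[OF assms(1)])
  from Cons.prems(3) have "m \<in> Poly_Mapping.keys (fold (rep_map (tree_module T F)) p ?y)" by simp
  then obtain n w where w: "n \<in> Poly_Mapping.keys ?y" "pre_digraph.awalk T n w m" "map (snd F) w = p"
    using Cons.IH y by blast
  from w(1) obtain a where a: "a \<in> arcs T" "tail T a \<in> Poly_Mapping.keys x" "snd F a = g" "head T a = n"
    by (rule keys_rep_map_tree_module)
  show ?case
    using Cons.prems(1)[of "tail T a" "a # w"] a w
    by (auto simp: pre_digraph.awalk_def pre_digraph.cas.simps wf_digraph.tail_in_verts[OF assms(1)])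
qed

lemma path_in_ideal_base: "p \<in> \<rho> \<Longrightarrow> path_in_ideal K Q \<rho> p"
  by (auto simp: path_in_ideal_def ideal_of_paths_def)

theorem representation_tree_module:
  fixes T :: "('n, 'b) pre_digraph"
  assumes T: "fin_digraph T" and F: "bound_morphism TYPE('k::field) T Q \<rho> F"
  shows "representation pm_scale Q \<rho> (tree_module T F :: ('v, 'e, 'n \<Rightarrow>\<^sub>0 'k) quiver_rep)"
proof -
  let ?M = "tree_module T F :: ('v, 'e, 'n \<Rightarrow>\<^sub>0 'k) quiver_rep"
  interpret fin_digraph T by fact
  have hom: "quiver_morphism T Q F" using F by (simp add: bound_morphism_def)
  have sp: "rep_space ?M q = {x. Poly_Mapping.keys x \<subseteq> {n \<in> verts T. fst F n = q}}" for q
    by (rule rep_space_tree_module) simp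
  have "\<exists>B. finite B \<and> pm.span B = rep_space ?M q" for q
    by (rule exI[of _ "basis_vec ` {n \<in> verts T. fst F n = q}"]) (simp add: tree_module_def)
  moreover have "pm.subspace (rep_space ?M q)" for q
    by (simp add: tree_module_def)
  moreover have "finite {q \<in> verts Q. rep_space ?M q \<noteq> {0}}"
  proof (rule finite_subset)
    show "{q \<in> verts Q. rep_space ?M q \<noteq> {0}} \<subseteq> fst F ` verts T"
    proof
      fix q assume "q \<in> {q \<in> verts Q. rep_space ?M q \<noteq> {0}}"
      then have "pm.span (basis_vec ` {n \<in> verts T. fst F n = q} :: ('n \<Rightarrow>\<^sub>0 'k) set) \<noteq> {0}"
        by (simp add: tree_module_def)
      then have "{n \<in> verts T. fst F n = q} \<noteq> {}"
        by (metis image_empty pm.span_empty)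
      then show "q \<in> fst F ` verts T" by auto
    qed
  qed simp
  moreover have "rep_map ?M a x \<in> rep_space ?M (head Q a)"
    if "a \<in> arcs Q" for a x
    using hom by (auto simp: sp quiver_morphism_def elim!: keys_rep_map_tree_module)
  moreover have "rep_map ?M a (x + y) = rep_map ?M a x + rep_map ?M a y" for a x y
    by (simp add: tree_module_def lookup_add pm.scale_left_distrib sum.distrib)
  moreover have "rep_map ?M a (pm_scale c x) = pm_scale c (rep_map ?M a x)" for a c x
    by (simp add: tree_module_def pm.scale_sum_right)
  moreover have "fold (rep_map ?M) (snd p) x = 0" if p: "p \<in> \<rho>" and x: "x \<in> rep_space ?M (fst p)" for p x
  proof (rule ccontr)
    assume "fold (rep_map ?M) (snd p) x \<noteq> 0"
    then obtain m where "m \<in> Poly_Mapping.keys (fold (rep_map ?M) (snd p) x)"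
      by (metis equals0I keys_eq_empty)
    moreover have "Poly_Mapping.keys x \<subseteq> verts T" using x by (auto simp: sp)
    ultimately obtain n w where w: "n \<in> Poly_Mapping.keys x" "awalk n w m" "map (snd F) w = snd p"
      using keys_path_tree_module[OF wf_digraph] by meson
    have "map_path F (n, w) = p"
      using w x by (auto simp: map_path_def sp prod_eq_iff)
    moreover have "(n, w) \<in> qpaths T" using w by (auto simp: qpaths_def)
    ultimately show False
      using F p path_in_ideal_base[of p \<rho>] unfolding bound_morphism_def by metis
  qed
  ultimately show ?thesis
    unfolding representation_def by blast
qed

end

theory Submission
  imports Defs
begin

text \<open>
  Given \<open>\<iota>: Br(n\<^sub>i) \<rightarrow> Br(n\<^sub>j)\<close>, pulling coefficients back along \<open>\<iota>\<close> is a homomorphism \<open>h: M\<^sub>j \<rightarrow> M\<^sub>i\<close> with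
  \<open>h v\<^sub>n\<^sub>j = v\<^sub>n\<^sub>i\<close>. The map that is the identity on \<open>M\<^sub>i\<close>, \<open>- h\<close> on \<open>M\<^sub>j\<close> and zero on \<open>v\<^sub>*\<close> and the other
  branches is an idempotent endomorphism of \<open>M\<close>: it commutes with the arrows at the root because
  \<open>F(a\<^sub>n\<^sub>i) = F(a\<^sub>n\<^sub>j)\<close>.

  Conversely, if an endomorphism \<open>f\<close> has a nonzero coefficient at \<open>y\<close> in \<open>f v\<^sub>x\<close>, then every child \<open>y'\<close> of
  \<open>y\<close> has a nonzero coefficient in \<open>f v\<^sub>x\<^sub>'\<close> for some child \<open>x'\<close> of \<open>x\<close> with the same label; iterating this
  gives a morphism \<open>Br(y) \<rightarrow> Br(x)\<close> over \<open>Q\<close>. A nontrivial idempotent \<open>e\<close> can be chosen with image in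
  \<open>\<Oplus>\<^sub>j M\<^sub>j\<close>. If (b) fails, the relations \<open>f (\<gamma> v\<^sub>*) = \<gamma> (f v\<^sub>*)\<close> show for each \<open>f = h e\<close> that \<open>v\<^sub>n\<^sub>j\<close> does not
  occur in \<open>f v\<^sub>n\<^sub>j\<close>, so the diagonal blocks of \<open>f\<close> are not surjective and hence nilpotent by Fitting's
  lemma. Then \<open>e\<close> lies in the Jacobson radical, so \<open>e = 0\<close>.
\<close>

section \<open>Equivariant endomorphisms\<close>

context vector_space
begin

text \<open>A vector of \<open>Z\<close> outside \<open>Y\<close> would extend a basis of
  \<open>Y\<close> to an independent subset of \<open>Z\<close> with \<open>dim Y + 1\<close>
  elements. The finite spanning set \<open>B\<close> makes these bases finite, so that their
  cardinalities can be compared.\<close>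

lemma subspace_eqI_dim:
  assumes "subspace Y" "Y \<subseteq> Z" "Z \<subseteq> span B" "finite B" "dim Z \<le> dim Y"
  shows "Y = Z"
proof (rule ccontr)
  assume "Y \<noteq> Z"
  then obtain z where z: "z \<in> Z" "z \<notin> Y" using assms(2) by blast
  obtain C where C: "C \<subseteq> Y" "independent C" "Y \<subseteq> span C" "card C = dim Y"
    using basis_exists by blast
  have finC: "finite C"
    using independent_span_bound[OF assms(4) C(2)] C(1) assms(2,3) by blast
  have sC: "span C = Y" using C(1,3) assms(1) by (simp add: span_minimal subset_antisym)
  have ind: "independent (insert z C)"
    using independent_insertI[of z C] C(2) sC z(2) by blast
  obtain D where D: "insert z C \<subseteq> D" "D \<subseteq> Z" "independent D" "Z \<subseteq> span D"
    using maximal_independent_subset_extend[of "insert z C" Z] ind z(1) C(1) assms(2) by blast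
  have "finite D" using independent_span_bound[OF assms(4) D(3)] D(2) assms(3) by blast
  moreover have "card D = dim Z" using D by (simp add: basis_card_eq_dim)
  moreover have "card (insert z C) = Suc (card C)"
    using finC C(1) z(2) by (metis card_insert_disjoint subsetD)
  ultimately have "Suc (dim Y) \<le> dim Z"
    using card_mono[of D "insert z C"] D(1) C(4) by simp
  with assms(5) show False by simp
qed

lemma decreasing_subspaces_stabilise:
  assumes sub: "\<And>i. subspace (Y i)" and dec: "\<And>i. Y (Suc i) \<subseteq> Y i"
    and B: "Y 0 \<subseteq> span B" "finite B"
  shows "\<exists>n. \<forall>m\<ge>n. Y m = Y n"
proof -
  have mono: "Y m \<subseteq> Y n" if "n \<le> m" for m n
    using lift_Suc_antimono_le[of Y, OF dec that] .
  obtain n where n: "\<And>m. dim (Y n) \<le> dim (Y m)"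
    using ex_has_least_nat[of "\<lambda>_. True" _ "\<lambda>n. dim (Y n)"] by blast
  have "Y m = Y n" if "n \<le> m" for m
    by (rule subspace_eqI_dim[OF sub mono[OF that] _ B(2) n]) (use mono[of 0 n] B(1) in auto)
  then show ?thesis by blast
qed

text \<open>The dimensions are bounded by \<open>card B\<close>, so a largest one exists; from its
  index on, all inclusions are equalities.\<close>

lemma increasing_subspaces_stabilise:
  assumes sub: "\<And>i. subspace (Y i)" and inc: "\<And>i. Y i \<subseteq> Y (Suc i)"
    and B: "\<And>i. Y i \<subseteq> span B" "finite B"
  shows "\<exists>n. \<forall>m\<ge>n. Y m = Y n"
proof -
  have mono: "Y n \<subseteq> Y m" if "n \<le> m" for m n
    using lift_Suc_mono_le[of Y, OF inc that] .
  have bd: "dim (Y m) \<le> card B" for m using dim_le_card[OF B] .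
  let ?D = "range (\<lambda>m. dim (Y m))"
  have fin: "finite ?D"
    by (rule finite_subset[of _ "{..card B}"]) (simp_all add: image_subset_iff bd)
  have "Max ?D \<in> ?D" by (rule Max_in[OF fin]) simp
  then obtain n where "Max ?D = dim (Y n)" by (rule imageE)
  then have n: "dim (Y m) \<le> dim (Y n)" for m
    using Max_ge[OF fin, of "dim (Y m)"] by simp
  have "Y n = Y m" if "n \<le> m" for m
    by (rule subspace_eqI_dim[OF sub mono[OF that] B n])
  then show ?thesis by blast
qed

end

section \<open>Linear maps commuting with a set of operators\<close>

locale operator_module = vector_space scale
  for scale :: "'a::field \<Rightarrow> 'b::ab_group_add \<Rightarrow> 'b" (infixr \<open>*s\<close> 75) +
  fixes A :: "('b \<Rightarrow> 'b) set"
  assumes operator_linear: "a \<in> A \<Longrightarrow> module_hom scale scale a"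
begin

text \<open>Homomorphisms are total functions of which only the values on \<open>X\<close> matter.
  In the applications \<open>X\<close> is a subspace invariant under \<open>A\<close>, so that
  \<open>f (a x)\<close> is again a value on \<open>X\<close>.\<close>

definition homs :: "'b set \<Rightarrow> 'b set \<Rightarrow> ('b \<Rightarrow> 'b) set" where
  "homs X Y = {f. f ` X \<subseteq> Y \<and>
     (\<forall>x\<in>X. \<forall>y\<in>X. f (x + y) = f x + f y) \<and> (\<forall>c. \<forall>x\<in>X. f (scale c x) = scale c (f x)) \<and>
     (\<forall>a\<in>A. \<forall>x\<in>X. f (a x) = a (f x))}"

lemma homsI:
  assumes "\<And>x. x \<in> X \<Longrightarrow> f x \<in> Y"
    and "\<And>x y. x \<in> X \<Longrightarrow> y \<in> X \<Longrightarrow> f (x + y) = f x + f y"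
    and "\<And>c x. x \<in> X \<Longrightarrow> f (scale c x) = scale c (f x)"
    and "\<And>a x. a \<in> A \<Longrightarrow> x \<in> X \<Longrightarrow> f (a x) = a (f x)"
  shows "f \<in> homs X Y"
  using assms by (auto simp: homs_def)

lemma homs_apply: "f \<in> homs X Y \<Longrightarrow> x \<in> X \<Longrightarrow> f x \<in> Y"
  and homs_add: "f \<in> homs X Y \<Longrightarrow> x \<in> X \<Longrightarrow> y \<in> X \<Longrightarrow> f (x + y) = f x + f y"
  and homs_scale: "f \<in> homs X Y \<Longrightarrow> x \<in> X \<Longrightarrow> f (scale c x) = scale c (f x)"
  and homs_commute: "f \<in> homs X Y \<Longrightarrow> a \<in> A \<Longrightarrow> x \<in> X \<Longrightarrow> f (a x) = a (f x)"
  by (auto simp: homs_def)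

lemma homs_mono: "f \<in> homs X Y \<Longrightarrow> X' \<subseteq> X \<Longrightarrow> Y \<subseteq> Y' \<Longrightarrow> f \<in> homs X' Y'"
  unfolding homs_def by blast

lemma homs_id: "id \<in> homs X X"
  by (simp add: homs_def)

lemma homs_comp: "f \<in> homs X Y \<Longrightarrow> g \<in> homs Y Z \<Longrightarrow> g \<circ> f \<in> homs X Z"
  unfolding homs_def by (simp add: image_subset_iff)

lemma homs_funpow: "f \<in> homs X X \<Longrightarrow> f ^^ n \<in> homs X X"
  by (induction n) (auto intro: homs_id[unfolded id_def] homs_comp simp: homs_id)

lemma homs_zero:
  assumes "f \<in> homs X Y" "subspace X" shows "f 0 = 0"
  using homs_scale[OF assms(1) subspace_0[OF assms(2)], of 0] by simp

lemma homs_diff_arg: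
  assumes "f \<in> homs X Y" "subspace X" "x \<in> X" "y \<in> X" shows "f (x - y) = f x - f y"
  using homs_add[OF assms(1) subspace_diff[OF assms(2-4)] assms(4)] by (simp add: algebra_simps)

lemma homs_sum_arg:
  assumes "f \<in> homs X Y" "subspace X" "\<And>i. i \<in> I \<Longrightarrow> x i \<in> X"
  shows "f (\<Sum>i\<in>I. x i) = (\<Sum>i\<in>I. f (x i))"
  using assms(3)
proof (induction I rule: infinite_finite_induct)
  case (insert i I)
  then show ?case
    using homs_add[OF assms(1), of "x i" "sum x I"] subspace_sum[OF assms(2), of I x] by simp
qed (simp_all add: homs_zero[OF assms(1,2)])

lemma homs_sum:
  assumes Y: "subspace Y" and f: "\<And>i. i \<in> I \<Longrightarrow> f i \<in> homs X Y"
  shows "(\<lambda>x. \<Sum>i\<in>I. f i x) \<in> homs X Y"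
proof (rule homsI)
  fix x assume x: "x \<in> X"
  show "(\<Sum>i\<in>I. f i x) \<in> Y"
    by (rule subspace_sum[OF Y homs_apply[OF f x]])
  show "(\<Sum>i\<in>I. f i (x + y)) = (\<Sum>i\<in>I. f i x) + (\<Sum>i\<in>I. f i y)" if "y \<in> X" for y
    unfolding sum.distrib[symmetric] by (rule sum.cong[OF refl homs_add[OF f x that]])
  show "(\<Sum>i\<in>I. f i (c *s x)) = c *s (\<Sum>i\<in>I. f i x)" for c
    unfolding scale_sum_right by (rule sum.cong[OF refl homs_scale[OF f x]])
  show "(\<Sum>i\<in>I. f i (a x)) = a (\<Sum>i\<in>I. f i x)" if a: "a \<in> A" for a
    unfolding module_hom.sum[OF operator_linear[OF a]] by (rule sum.cong[OF refl homs_commute[OF f a x]])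
qed

lemma homs_diff:
  assumes Y: "subspace Y" and f: "f \<in> homs X Y" and g: "g \<in> homs X Y"
  shows "(\<lambda>x. f x - g x) \<in> homs X Y"
proof (rule homsI)
  fix x assume x: "x \<in> X"
  show "f x - g x \<in> Y"
    by (rule subspace_diff[OF Y homs_apply[OF f x] homs_apply[OF g x]])
  show "f (x + y) - g (x + y) = f x - g x + (f y - g y)" if "y \<in> X" for y
    by (simp add: homs_add[OF f x that] homs_add[OF g x that])
  show "f (c *s x) - g (c *s x) = c *s (f x - g x)" for c
    by (simp add: homs_scale[OF f x] homs_scale[OF g x] scale_right_diff_distrib)
  show "f (a x) - g (a x) = a (f x - g x)" if a: "a \<in> A" for a
    unfolding module_hom.diff[OF operator_linear[OF a]] homs_commute[OF f a x] homs_commute[OF g a x] ..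
qed

text \<open>The inverse of \<open>1 - f\<close> is the geometric series, which is finite because
  \<open>f\<close> is nilpotent; the product telescopes.\<close>

lemma nilpotent_imp_left_inverse:
  assumes X: "subspace X"
    and f: "f \<in> homs X X" and nil: "\<And>x. x \<in> X \<Longrightarrow> (f ^^ n) x = 0"
  shows "\<exists>u\<in>homs X X. \<forall>x\<in>X. u (x - f x) = x"
proof (intro bexI ballI)
  let ?u = "\<lambda>x. \<Sum>i<n. (f ^^ i) x"
  show "?u \<in> homs X X" by (intro homs_sum X homs_funpow f)
  fix x assume x: "x \<in> X"
  have "?u (x - f x) = (\<Sum>i<n. (f ^^ i) x - (f ^^ Suc i) x)"
    using homs_diff_arg[OF homs_funpow[OF f] X x homs_apply[OF f x]]
    by (simp add: funpow_swap1)
  also have "\<dots> = x - (f ^^ n) x" by (subst sum_lessThan_telescope') simp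
  finally show "?u (x - f x) = x" using nil[OF x] by simp
qed

text \<open>The hypothesis puts every \<open>e \<circ> p j\<close> into the Jacobson radical of the endomorphism ring;
  hence \<open>e\<close>, their sum, lies there too, and the radical contains no nonzero idempotents.\<close>

lemma idempotent_eq_0:
  assumes X: "subspace X" and J: "finite J"
    and e: "e \<in> homs X X" and idem: "\<And>x. x \<in> X \<Longrightarrow> e (e x) = e x"
    and p: "\<And>j. j \<in> J \<Longrightarrow> p j \<in> homs X X" and psum: "\<And>x. x \<in> X \<Longrightarrow> (\<Sum>j\<in>J. p j x) = x"
    and nil: "\<And>j h. j \<in> J \<Longrightarrow> h \<in> homs X X \<Longrightarrow> \<exists>n. \<forall>x\<in>X. ((h \<circ> e \<circ> p j) ^^ n) x = 0"
    and x: "x \<in> X"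
  shows "e x = 0"
proof -
  \<comment> \<open>The sum over \<open>J\<close> is treated one summand at a time: for each
    \<open>J' \<subseteq> J\<close>, the identity minus the partial sum has a left inverse.\<close>
  have "\<exists>u\<in>homs X X. \<forall>x\<in>X. u (x - (\<Sum>j\<in>J'. e (p j x))) = x" if "J' \<subseteq> J" for J'
    using finite_subset[OF that J] that
  proof (induction J')
    case empty
    then show ?case by (intro bexI[OF _ homs_id]) simp
  next
    case (insert k J')
    then obtain u where u: "u \<in> homs X X" "\<And>x. x \<in> X \<Longrightarrow> u (x - (\<Sum>j\<in>J'. e (p j x))) = x"
      by auto
    \<comment> \<open>Applying \<open>u\<close> to the identity minus the sum over
      \<open>insert k J'\<close> leaves \<open>1 - ?f\<close>. The hypothesis \<open>nil\<close>
      with \<open>h = u\<close> makes \<open>?f\<close> nilpotent, which gives the remaining factor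
      \<open>v\<close>.\<close>
    let ?f = "u \<circ> e \<circ> p k"
    from insert have k: "k \<in> J" by auto
    have f: "?f \<in> homs X X" by (intro homs_comp[OF p[OF k]] homs_comp[OF e] u)
    obtain n where "\<forall>x\<in>X. (?f ^^ n) x = 0" using nil[OF k u(1)] by blast
    then obtain v where v: "v \<in> homs X X" "\<And>x. x \<in> X \<Longrightarrow> v (x - ?f x) = x"
      using nilpotent_imp_left_inverse[OF X f] by blast
    show ?case
    proof (intro bexI ballI)
      show "v \<circ> u \<in> homs X X" by (intro homs_comp[OF u(1)] v)
      fix x assume x: "x \<in> X"
      have ep: "e (p j x) \<in> X" if "j \<in> J" for j
        using homs_apply[OF e homs_apply[OF p[OF that] x]] .
      then have sm: "(\<Sum>j\<in>J'. e (p j x)) \<in> X"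
        using insert.prems by (intro subspace_sum X) auto
      have "x - (\<Sum>j\<in>insert k J'. e (p j x)) = (x - (\<Sum>j\<in>J'. e (p j x))) - e (p k x)"
        using insert.hyps by simp
      then have "u (x - (\<Sum>j\<in>insert k J'. e (p j x))) = x - ?f x"
        by (simp only: homs_diff_arg[OF u(1) X subspace_diff[OF X x sm] ep[OF k]] u(2)[OF x] o_apply)
      then show "(v \<circ> u) (x - (\<Sum>j\<in>insert k J'. e (p j x))) = x"
        using v(2)[OF x] by simp
    qed
  qed
  from this[OF subset_refl] obtain u where u: "u \<in> homs X X"
    "\<And>x. x \<in> X \<Longrightarrow> u (x - (\<Sum>j\<in>J. e (p j x))) = x" by blast
  have "(\<Sum>j\<in>J. e (p j y)) = e y" if "y \<in> X" for y
    using homs_sum_arg[OF e X, of J "\<lambda>j. p j y"] homs_apply[OF p that] psum[OF that] by simp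
  \<comment> \<open>For \<open>J' = J\<close> the map \<open>u\<close> is a left inverse of
    \<open>1 - e\<close>, while \<open>1 - e\<close> kills the image of the idempotent
    \<open>e\<close>.\<close>
  then have "u (e x - e (e x)) = e x" using u(2)[of "e x"] homs_apply[OF e x] by simp
  then show ?thesis using idem[OF x] homs_zero[OF u(1) X] by simp
qed

text \<open>The images of the powers of \<open>f\<close> decrease and their kernels increase, so
  both become constant. The last two conclusions say that \<open>X\<close> is the sum of the image
  and the kernel of \<open>f ^^ n\<close>, and that these meet only in zero.\<close>

lemma fitting:
  assumes X: "subspace X" "X \<subseteq> span B" "finite B" and f: "f \<in> homs X X"
  obtains n where "0 < n" "\<And>x. x \<in> X \<Longrightarrow> \<exists>y\<in>X. (f ^^ n) x = (f ^^ n) ((f ^^ n) y)"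
    "\<And>x. x \<in> X \<Longrightarrow> (f ^^ n) ((f ^^ n) x) = 0 \<Longrightarrow> (f ^^ n) x = 0"
proof -
  let ?I = "\<lambda>i. (f ^^ i) ` X" and ?K = "\<lambda>i. {x \<in> X. (f ^^ i) x = 0}"
  note h = homs_funpow[OF f]
  have "subspace (?I i)" for i
    unfolding subspace_def
    by (auto simp: homs_add[OF h, symmetric] homs_scale[OF h, symmetric]
        intro!: imageI subspace_add[OF X(1)] subspace_scale[OF X(1)])
      (metis X(1) h homs_zero image_iff subspace_0)
  moreover have "?I (Suc i) \<subseteq> ?I i" for i
    using homs_apply[OF f] by (auto simp: funpow_swap1)
  ultimately obtain m where m: "\<And>k. k \<ge> m \<Longrightarrow> ?I k = ?I m"
    using decreasing_subspaces_stabilise[of ?I B] X by auto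
  have "subspace (?K i)" for i
    unfolding subspace_def
    by (auto simp: homs_add[OF h] homs_scale[OF h] homs_zero[OF h X(1)]
        intro!: subspace_add[OF X(1)] subspace_scale[OF X(1)] subspace_0[OF X(1)])
  moreover have "?K i \<subseteq> ?K (Suc i)" for i
    using homs_zero[OF f X(1)] by auto
  moreover have "?K i \<subseteq> span B" for i using X(2) by auto
  ultimately obtain k where k: "\<And>i. i \<ge> k \<Longrightarrow> ?K i = ?K k"
    using increasing_subspaces_stabilise[of ?K B] X(3) by auto
  \<comment> \<open>From this exponent on both chains are constant, so it can be compared with its
    double; \<open>Suc\<close> makes it positive.\<close>
  let ?n = "Suc (max m k)"
  have I: "?I ?n = ?I (?n + ?n)" using m[of ?n] m[of "?n + ?n"] by (simp only: le_SucI le_add1 max.cobounded1 trans_le_add1)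
  have K: "?K ?n = ?K (?n + ?n)" using k[of ?n] k[of "?n + ?n"] by (simp only: le_SucI max.cobounded2 trans_le_add1)
  show thesis
  proof (rule that[of ?n])
    show "0 < ?n" by simp
  next
    fix x assume x: "x \<in> X"
    then have "(f ^^ ?n) x \<in> ?I (?n + ?n)" unfolding I[symmetric] by (rule imageI)
    then show "\<exists>y\<in>X. (f ^^ ?n) x = (f ^^ ?n) ((f ^^ ?n) y)"
      unfolding image_iff funpow_add o_apply .
    assume "(f ^^ ?n) ((f ^^ ?n) x) = 0"
    with x have "x \<in> ?K (?n + ?n)" unfolding funpow_add o_apply by blast
    then show "(f ^^ ?n) x = 0" unfolding K[symmetric] by blast
  qed
qed

text \<open>\<open>e x\<close> is the \<open>U\<close>-component of \<open>x\<close>. As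
  \<open>U\<close> and \<open>W\<close> meet only in zero, it is the only \<open>u \<in> U\<close>
  with \<open>x - u \<in> W\<close>; each law for \<open>e\<close> follows by checking these two
  properties.\<close>

lemma complement_projection:
  assumes X: "subspace X" and U: "subspace U" "U \<subseteq> X" and W: "subspace W" "W \<subseteq> X"
    and inv: "\<And>a u. a \<in> A \<Longrightarrow> u \<in> U \<Longrightarrow> a u \<in> U" "\<And>a w. a \<in> A \<Longrightarrow> w \<in> W \<Longrightarrow> a w \<in> W"
    and sum: "\<And>x. x \<in> X \<Longrightarrow> \<exists>u\<in>U. x - u \<in> W" and int: "U \<inter> W = {0}"
  obtains e where "e \<in> homs X X" "\<And>x. x \<in> X \<Longrightarrow> e x \<in> U" "\<And>u. u \<in> U \<Longrightarrow> e u = u"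
    "\<And>w. w \<in> W \<Longrightarrow> e w = 0"
proof -
  define e where "e x = (SOME u. u \<in> U \<and> x - u \<in> W)" for x
  have e: "e x \<in> U" "x - e x \<in> W" if "x \<in> X" for x
    using someI_ex[of "\<lambda>u. u \<in> U \<and> x - u \<in> W"] sum[OF that] unfolding e_def by blast+
  have eI: "e x = u" if "x \<in> X" "u \<in> U" "x - u \<in> W" for x u
  proof -
    have "e x - u \<in> U" using subspace_diff[OF U(1) e(1)[OF that(1)] that(2)] .
    moreover have "(x - u) - (x - e x) \<in> W" using subspace_diff[OF W(1) that(3) e(2)[OF that(1)]] .
    then have "e x - u \<in> W" by simp
    ultimately have "e x - u = 0" using int by blast
    then show ?thesis by simp
  qed
  show thesis
  proof (rule that)
    show "e \<in> homs X X"
    proof (rule homsI)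
      fix x assume x: "x \<in> X"
      show "e x \<in> X" using e(1)[OF x] U(2) by blast
      show "e (x + y) = e x + e y" if y: "y \<in> X" for y
      proof (rule eI)
        show "x + y - (e x + e y) \<in> W"
          using subspace_add[OF W(1) e(2)[OF x] e(2)[OF y]] by (simp add: algebra_simps)
      qed (intro subspace_add[OF X] x y subspace_add[OF U(1)] e)+
      show "e (c *s x) = c *s e x" for c
      proof (rule eI)
        show "c *s x - c *s e x \<in> W"
          using subspace_scale[OF W(1) e(2)[OF x], of c] by (simp add: scale_right_diff_distrib)
      qed (intro subspace_scale[OF X] x subspace_scale[OF U(1)] e)+
      show "e (a x) = a (e x)" if a: "a \<in> A" for a
      proof (rule eI)
        have *: "a x = a (e x) + a (x - e x)"
          by (simp add: module_hom.diff[OF operator_linear[OF a]])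
        show "a (e x) \<in> U" using inv(1)[OF a e(1)[OF x]] .
        show "a x - a (e x) \<in> W" using inv(2)[OF a e(2)[OF x]] * by simp
        then show "a x \<in> X"
          unfolding * using subspace_add[OF X] \<open>a (e x) \<in> U\<close> inv(2)[OF a e(2)[OF x]] U(2) W(2) by blast
      qed
    qed
    show "e x \<in> U" if "x \<in> X" for x using e(1)[OF that] .
    show "e u = u" if "u \<in> U" for u
      by (rule eI) (use that U(2) subspace_0[OF W(1)] in auto)
    show "e w = 0" if "w \<in> W" for w
      by (rule eI) (use that W(2) subspace_0[OF U(1)] in auto)
  qed
qed

end

section \<open>Rooted trees\<close>

lemma underlying_simps [simp]:
  "verts (underlying T) = verts T" "arcs (underlying T) = arcs T \<times> UNIV"
  "tail (underlying T) (a, b) = (if b then head T a else tail T a)"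
  "head (underlying T) (a, b) = (if b then tail T a else head T a)"
  by (simp_all add: underlying_def)

lemma wf_digraph_underlying: "wf_digraph T \<Longrightarrow> wf_digraph (underlying T)"
  by (auto simp: wf_digraph_def)

lemma awalk_underlying:
  assumes "wf_digraph T" "pre_digraph.awalk T u p v"
  shows "pre_digraph.awalk (underlying T) u (map (\<lambda>a. (a, False)) p) v"
    and "pre_digraph.awalk (underlying T) v (map (\<lambda>a. (a, True)) (rev p)) u"
proof -
  interpret wf_digraph T by fact
  interpret U: wf_digraph "underlying T" using wf_digraph_underlying[OF assms(1)] .
  show "U.awalk u (map (\<lambda>a. (a, False)) p) v"
    using assms(2) by (induction p arbitrary: u) (auto simp: awalk_simps U.awalk_simps)
  show "U.awalk v (map (\<lambda>a. (a, True)) (rev p)) u"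
    using assms(2)
  proof (induction p arbitrary: u)
    case (Cons a p)
    then have a: "a \<in> arcs T" "u = tail T a" and "U.awalk v (map (\<lambda>a. (a, True)) (rev p)) (head T a)"
      by (auto simp: awalk_simps)
    moreover have "U.awalk (head T a) [(a, True)] u"
      using a by (simp add: U.awalk_simps)
    ultimately show ?case using U.awalk_appendI by fastforce
  qed (auto simp: awalk_simps U.awalk_simps)
qed

text \<open>The vertex from which an arrow is first traversed is one of its two ends, so a second
  traversal in either direction would visit this vertex again.\<close>

lemma distinct_arcs_underlying:
  assumes "wf_digraph T" "pre_digraph.awalk (underlying T) u p v"
    and "distinct (pre_digraph.awalk_verts (underlying T) u p)"
  shows "distinct (map fst p)"
proof -
  interpret U: wf_digraph "underlying T" using wf_digraph_underlying[OF assms(1)] .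
  show ?thesis
    using assms(2,3)
  proof (induction p arbitrary: u)
    case (Cons e p)
    then have e: "u = tail (underlying T) e" "U.awalk (head (underlying T) e) p v"
      and d: "u \<notin> set (U.awalk_verts (head (underlying T) e) p)"
        "distinct (U.awalk_verts (head (underlying T) e) p)"
      by (auto simp: U.awalk_simps)
    have "fst e \<notin> fst ` set p"
    proof
      assume "fst e \<in> fst ` set p"
      then obtain e' where e': "e' \<in> set p" "fst e = fst e'" by auto
      have "u = tail (underlying T) e' \<or> u = head (underlying T) e'"
        using e(1) e'(2) by (cases e; cases e') simp
      then show False
        using U.awalk_verts_arc1[OF e'(1)] U.awalk_verts_arc2[OF e(2) e'(1)] d(1) by auto
    qed
    with Cons.IH[OF e(2) d(2)] show ?case by simp
  qed simp
qed

text \<open>Removing an arrow of a tree disconnects its endpoints.\<close>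

lemma tree_quiver_no_bypass:
  assumes T: "tree_quiver T" and a: "a \<in> arcs T"
    and p: "pre_digraph.awalk (underlying T) (head T a) p (tail T a)" and avoid: "a \<notin> fst ` set p"
  shows False
proof -
  interpret fin_digraph T using T by (simp add: tree_quiver_def)
  interpret U: wf_digraph "underlying T" using wf_digraph_underlying[OF wf_digraph] .
  \<comment> \<open>Without repeated vertices the walk has distinct arrows, and together with
    \<open>a\<close> it closes up to a forbidden cycle.\<close>
  define q where "q = U.awalk_to_apath p"
  have q: "U.apath (head T a) q (tail T a)" unfolding q_def by (rule U.apath_awalk_to_apath[OF p])
  then have qd: "U.awalk (head T a) q (tail T a)" "distinct (U.awalk_verts (head T a) q)"
    by (auto simp: U.apath_def)
  have "a \<notin> fst ` set q" using U.awalk_to_apath_subset[OF p] avoid by (auto simp: q_def)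
  then have "distinct (map fst ((a, False) # q))"
    using distinct_arcs_underlying[OF wf_digraph qd] by simp
  moreover have "U.awalk (tail T a) ((a, False) # q) (tail T a)"
    using a qd(1) by (simp add: U.awalk_simps)
  then have "U.cycle ((a, False) # q)"
    using qd(2) unfolding U.cycle_def by (intro exI[of _ "tail T a"]) simp
  ultimately show False using T unfolding tree_quiver_def by blast
qed

text \<open>An oriented cycle with its first arrow removed would bypass that arrow.\<close>

lemma acyclic_tree_quiver:
  assumes T: "tree_quiver T"
  shows "acyclic (arcs_ends T)"
proof (rule acyclicI, rule allI, rule notI)
  interpret fin_digraph T using T by (simp add: tree_quiver_def)
  fix n assume "n \<rightarrow>\<^sup>+\<^bsub>T\<^esub> n"
  then obtain p where "awalk n p n" "p \<noteq> []" by (auto simp: reachable1_awalk)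
  then obtain c where "cycle c" using closed_w_imp_cycle unfolding closed_w_def by blast
  then obtain u a q where "c = a # q" "awalk u (a # q) u" "distinct (a # q)"
    unfolding cycle_conv by (metis list.exhaust)
  then have "a \<in> arcs T" "awalk (head T a) q (tail T a)" "a \<notin> set q"
    by (auto simp: awalk_simps)
  then show False
    using tree_quiver_no_bypass[OF T, of a "map (\<lambda>a. (a, False)) q"] awalk_underlying(1)[OF wf_digraph]
    by force
qed

section \<open>Parents, reachability and branches in a rooted tree\<close>

locale rooted_tree_quiver = fin_digraph T for T :: "('n, 'b) pre_digraph" (structure) +
  fixes r :: 'n
  assumes rooted: "rooted_tree T r"
begin

lemma tree: "tree_quiver T"
  using rooted by (simp add: rooted_tree_def)

lemma root_in_verts: "r \<in> verts T"
  and no_arc_to_root: "a \<in> arcs T \<Longrightarrow> head T a \<noteq> r"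
  and ex_arc_to: "m \<in> verts T \<Longrightarrow> m \<noteq> r \<Longrightarrow> \<exists>a\<in>arcs T. head T a = m"
  using rooted unfolding rooted_tree_def in_arcs_def set_eq_iff by auto

lemma not_reachable1_self: "\<not> n \<rightarrow>\<^sup>+ n"
  using acyclic_tree_quiver[OF tree] by (auto simp: acyclic_def)

lemma finite_arcs_ends: "finite (arcs_ends T)"
  by (simp add: arcs_ends_conv)

lemma wf_arcs_ends: "wf (arcs_ends T)"
  using finite_acyclic_wf[OF finite_arcs_ends acyclic_tree_quiver[OF tree]] .

lemma wf_arcs_ends_converse: "wf ((arcs_ends T)\<inverse>)"
  using finite_acyclic_wf_converse[OF finite_arcs_ends acyclic_tree_quiver[OF tree]] .

text \<open>By finiteness and acyclicity, going backwards along arrows stops at a vertex without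
  incoming arrows, and the root is the only one.\<close>

lemma root_reaches: "n \<in> verts T \<Longrightarrow> r \<rightarrow>\<^sup>* n"
proof (induction n rule: wf_induct_rule[OF wf_arcs_ends])
  case (1 n)
  show ?case
  proof (cases "n = r")
    case False
    then obtain a where a: "a \<in> arcs T" "head T a = n" using ex_arc_to 1 by blast
    then have "tail T a \<rightarrow> n" using in_arcs_imp_in_arcs_ends by blast
    with 1 a show ?thesis using reachable_adj_trans tail_in_verts by blast
  qed (use 1 in simp)
qed

text \<open>If \<open>a\<close> and \<open>b\<close> had the same target, one could leave it against
  \<open>b\<close>, climb to the root and descend to the tail of \<open>a\<close>, thereby bypassing
  \<open>a\<close>.\<close>

lemma arc_to_unique:
  assumes a: "a \<in> arcs T" and b: "b \<in> arcs T" and eq: "head T a = head T b"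
  shows "a = b"
proof (rule ccontr)
  assume ne: "a \<noteq> b"
  interpret U: wf_digraph "underlying T" using wf_digraph_underlying[OF wf_digraph] .
  obtain p where p: "awalk r p (tail T a)" using root_reaches[of "tail T a"] a by (auto simp: reachable_awalk)
  obtain q where q: "awalk r q (tail T b)" using root_reaches[of "tail T b"] b by (auto simp: reachable_awalk)
  \<comment> \<open>If a walk from the root to the tail of \<open>c\<close> used \<open>a\<close>,
    it would pass through the common target of \<open>a\<close> and \<open>c\<close>, and
    \<open>c\<close> would close an oriented cycle.\<close>
  have avoid: False if "awalk r w (tail T c)" "a \<in> set w" "c \<in> arcs T" "head T c = head T a" for w c
  proof -
    have "head T a \<in> set (awalk_verts r w)" using awalk_verts_arc2 that by blast
    then have "head T a \<rightarrow>\<^sup>* tail T c" using awalk_verts_reachable_to that by blast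
    moreover have "tail T c \<rightarrow> head T a" using in_arcs_imp_in_arcs_ends[OF that(3)] that(4) by simp
    ultimately show False using not_reachable1_self reachable_reachable1_trans by blast
  qed
  have "U.awalk (head T a) [(b, True)] (tail T b)"
    using b eq by (simp add: U.awalk_simps)
  then have "U.awalk (head T a) (([(b, True)] @ map (\<lambda>a. (a, True)) (rev q)) @ map (\<lambda>a. (a, False)) p) (tail T a)"
    by (rule U.awalk_appendI[OF U.awalk_appendI[OF _ awalk_underlying(2)[OF wf_digraph q]]
        awalk_underlying(1)[OF wf_digraph p]])
  moreover have "a \<notin> set p" "a \<notin> set q" using avoid[OF p _ a] avoid[OF q _ b] eq by auto
  then have "a \<notin> fst ` set (([(b, True)] @ map (\<lambda>a. (a, True)) (rev q)) @ map (\<lambda>a. (a, False)) p)"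
    using ne by auto
  ultimately show False by (rule tree_quiver_no_bypass[OF tree a])
qed

lemma in_arrow_head: "a \<in> arcs T \<Longrightarrow> in_arrow T (head T a) = a"
  unfolding in_arrow_def by (rule the_equality) (auto intro: arc_to_unique)

lemma in_arrow_in_arcs: "m \<in> verts T \<Longrightarrow> m \<noteq> r \<Longrightarrow> in_arrow T m \<in> arcs T"
  and head_in_arrow: "m \<in> verts T \<Longrightarrow> m \<noteq> r \<Longrightarrow> head T (in_arrow T m) = m"
  by (drule (1) ex_arc_to, clarsimp simp: in_arrow_head)+

lemma arcs_eq: "arcs T = in_arrow T ` (verts T - {r})"
proof
  show "arcs T \<subseteq> in_arrow T ` (verts T - {r})"
  proof
    fix a assume "a \<in> arcs T"
    then show "a \<in> in_arrow T ` (verts T - {r})"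
      by (intro image_eqI[of _ _ "head T a"]) (simp_all add: in_arrow_head no_arc_to_root)
  qed
qed (use in_arrow_in_arcs in blast)

lemma dominates_iff: "n \<rightarrow> m \<longleftrightarrow> m \<in> verts T \<and> m \<noteq> r \<and> n = parent T m"
proof
  assume "n \<rightarrow> m"
  then obtain a where "a \<in> arcs T" "tail T a = n" "head T a = m" by blast
  then show "m \<in> verts T \<and> m \<noteq> r \<and> n = parent T m"
    using no_arc_to_root in_arrow_head by (auto simp: parent_def)
next
  assume "m \<in> verts T \<and> m \<noteq> r \<and> n = parent T m"
  then show "n \<rightarrow> m"
    using in_arcs_imp_in_arcs_ends[OF in_arrow_in_arcs, of m] by (simp add: parent_def head_in_arrow)
qed

lemma parent_reachable:
  assumes "n \<rightarrow>\<^sup>* m" "m \<noteq> n"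
  shows "m \<noteq> r" "n \<rightarrow>\<^sup>* parent T m"
proof -
  have "n \<rightarrow>\<^sup>+ m" using assms by (simp add: reachable_neq_reachable1)
  then obtain x where "(n, x) \<in> (arcs_ends T)\<^sup>*" "x \<rightarrow> m" by (meson tranclD2)
  then have "n \<rightarrow>\<^sup>* x" "x \<rightarrow> m"
    using reachable_conv' reachable_in_verts(1)[OF assms(1)] by auto
  then show "m \<noteq> r" "n \<rightarrow>\<^sup>* parent T m" by (auto simp: dominates_iff)
qed

lemma reachable_parentI:
  assumes "n \<rightarrow>\<^sup>* parent T m" "m \<in> verts T" "m \<noteq> r" shows "n \<rightarrow>\<^sup>* m"
  by (rule reachable_adj_trans[OF assms(1)]) (simp add: dominates_iff assms)

lemma reachable_antisym:
  assumes "n \<rightarrow>\<^sup>* m" "m \<rightarrow>\<^sup>* n" shows "n = m"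
proof (rule ccontr)
  assume "n \<noteq> m"
  then have "n \<rightarrow>\<^sup>+ n"
    using reachable1_reachable_trans[OF reachable_neq_reachable1[OF assms(1)] assms(2)] by simp
  then show False using not_reachable1_self by simp
qed

lemma not_reaches_root: "n \<rightarrow>\<^sup>* r \<Longrightarrow> n = r"
  by (rule reachable_antisym[OF _ root_reaches[OF reachable_in_verts(1)]])

lemma child_reaches:
  assumes "m \<in> verts T" "m \<noteq> r"
  obtains n where "n \<in> verts T" "n \<noteq> r" "parent T n = r" "n \<rightarrow>\<^sup>* m"
  using root_reaches[OF assms(1)]
proof (cases rule: converse_reachable_cases)
  case (step n)
  then show thesis unfolding dominates_iff by (metis that)
qed (use assms in simp)

text \<open>Induction along the path from \<open>n\<close> to \<open>m\<close>: since parents are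
  unique, a path from \<open>n'\<close> to a vertex other than \<open>n'\<close> passes through the
  parent of that vertex.\<close>

lemma child_reaches_unique:
  assumes n: "n \<noteq> r" "parent T n = r" "n \<rightarrow>\<^sup>* m"
    and n': "n' \<noteq> r" "parent T n' = r" "n' \<rightarrow>\<^sup>* m"
  shows "n = n'"
  using n(3) n'(3)
proof (induction rule: reachable_induct)
  case base
  then show ?case
    using parent_reachable(2)[of n' n] not_reaches_root[of n'] n(2) n'(1) by (cases "n = n'") simp_all
next
  case (step x y)
  then have y: "y \<noteq> r" "x = parent T y" by (simp_all add: dominates_iff)
  show ?case
  proof (cases "y = n'")
    case True
    then show ?thesis using step.hyps(1) y(2) n(1) n'(2) not_reaches_root[of n] by simp
  next
    case False
    then show ?thesis using parent_reachable(2)[OF step.prems] step.IH y(2) by simp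
  qed
qed

lemma verts_branch: "verts (branch T n) = {m. n \<rightarrow>\<^sup>* m}"
  and arcs_branch: "arcs (branch T n) = in_arrow T ` ({m. n \<rightarrow>\<^sup>* m} - {n})"
  and tail_branch: "tail (branch T n) = tail T"
  and head_branch: "head (branch T n) = head T"
  by (simp_all add: branch_def)

lemma branch_root: "branch T r = T"
proof -
  have "{m. r \<rightarrow>\<^sup>* m} = verts T" using root_reaches reachable_in_verts(2) by blast
  then show ?thesis by (simp add: branch_def arcs_eq[symmetric])
qed

end

section \<open>Endomorphisms of tree modules\<close>

definition restr :: "'n set \<Rightarrow> ('n \<Rightarrow>\<^sub>0 'k::zero) \<Rightarrow> ('n \<Rightarrow>\<^sub>0 'k)" where
  "restr Z = Poly_Mapping.mapp (\<lambda>n c. c when n \<in> Z)"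

lemma lookup_restr [simp]:
  "Poly_Mapping.lookup (restr Z x) n = (if n \<in> Z then Poly_Mapping.lookup x n else 0)"
  by (simp add: restr_def lookup_mapp when_def in_keys_iff)

lemma module_hom_restr: "module_hom pm_scale pm_scale (restr Z :: ('n \<Rightarrow>\<^sub>0 'k::field) \<Rightarrow> _)"
  by unfold_locales (auto intro!: poly_mapping_eqI simp: lookup_add)

definition supported :: "'n set \<Rightarrow> ('n \<Rightarrow>\<^sub>0 'k::zero) set" where
  "supported Z = {x. Poly_Mapping.keys x \<subseteq> Z}"

lemma supported_iff: "x \<in> supported Z \<longleftrightarrow> (\<forall>n. n \<notin> Z \<longrightarrow> Poly_Mapping.lookup x n = 0)"
  by (auto simp: supported_def in_keys_iff)

lemma supported_mono: "Y \<subseteq> Z \<Longrightarrow> supported Y \<subseteq> supported Z"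
  by (auto simp: supported_def)

lemma subspace_supported: "pm.subspace (supported Z)"
  by (auto simp: pm.subspace_def supported_iff lookup_add)

lemma basis_vec_in_supported: "n \<in> Z \<Longrightarrow> basis_vec n \<in> supported Z"
  by (auto simp: supported_iff lookup_single when_def)

lemma sum_basis_vec:
  assumes "finite Z" "x \<in> supported Z"
  shows "x = (\<Sum>n\<in>Z. pm_scale (Poly_Mapping.lookup x n) (basis_vec n))"
  using assms by (intro poly_mapping_eqI)
    (auto simp: lookup_sum lookup_single when_def supported_iff if_distrib cong: if_cong)

lemma supported_subset_span:
  assumes "finite Z"
  shows "(supported Z :: ('n \<Rightarrow>\<^sub>0 'k::field) set) \<subseteq> pm.span (basis_vec ` Z)"
proof
  fix x :: "'n \<Rightarrow>\<^sub>0 'k" assume "x \<in> supported Z"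
  then have "x = (\<Sum>n\<in>Z. pm_scale (Poly_Mapping.lookup x n) (basis_vec n))"
    by (rule sum_basis_vec[OF assms])
  also have "\<dots> \<in> pm.span (basis_vec ` Z)"
    by (intro pm.span_sum pm.span_scale pm.span_base imageI)
  finally show "x \<in> pm.span (basis_vec ` Z)" .
qed

section \<open>The tree module and the submodules given by branches\<close>

locale tree_over = rooted_tree_quiver T r
  for T :: "('n, 'b) pre_digraph" (structure) and r +
  fixes Q :: "('v, 'e) pre_digraph" and F :: "('n, 'b, 'v, 'e) quiver_map" and K :: "'k::field itself"
  assumes morphism: "quiver_morphism T Q F"
begin

abbreviation col :: "'n \<Rightarrow> 'v" where "col \<equiv> fst F"

text \<open>An arrow of a rooted tree is determined by its target, so labels of arrows become labels
  of vertices other than the root.\<close>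

definition lab :: "'n \<Rightarrow> 'e" where "lab m = snd F (in_arrow T m)"

definition br :: "'n \<Rightarrow> 'n set" where "br n = {m. n \<rightarrow>\<^sup>* m}"

definition tm :: "('n, 'b) pre_digraph \<Rightarrow> ('v, 'e, 'n \<Rightarrow>\<^sub>0 'k) quiver_rep" where
  "tm B = tree_module B F"

definition act :: "'e \<Rightarrow> ('n \<Rightarrow>\<^sub>0 'k) \<Rightarrow> ('n \<Rightarrow>\<^sub>0 'k)" where
  "act = rep_map (tm T)"

definition part :: "'v \<Rightarrow> ('n \<Rightarrow>\<^sub>0 'k) \<Rightarrow> ('n \<Rightarrow>\<^sub>0 'k)" where
  "part q = restr {m. col m = q}"

text \<open>Among the subsets of \<open>verts T\<close>, these are the ones for which
  \<open>supported Z\<close> is invariant under the arrows.\<close>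

definition descendant_closed :: "'n set \<Rightarrow> bool" where
  "descendant_closed Z \<longleftrightarrow> Z \<subseteq> verts T \<and> (\<forall>m\<in>verts T - {r}. parent T m \<in> Z \<longrightarrow> m \<in> Z)"

lemma col_in_verts: "m \<in> verts T \<Longrightarrow> col m \<in> verts Q"
  using morphism by (auto simp: quiver_morphism_def)

lemma lab_in_arcs: "m \<in> verts T \<Longrightarrow> m \<noteq> r \<Longrightarrow> lab m \<in> arcs Q"
  and col_head: "m \<in> verts T \<Longrightarrow> m \<noteq> r \<Longrightarrow> col m = head Q (lab m)"
  and col_parent: "m \<in> verts T \<Longrightarrow> m \<noteq> r \<Longrightarrow> col (parent T m) = tail Q (lab m)"
  using morphism in_arrow_in_arcs[of m] head_in_arrow[of m]
  unfolding quiver_morphism_def lab_def parent_def by force+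

lemma br_subset: "n \<in> verts T \<Longrightarrow> br n \<subseteq> verts T"
  using reachable_in_verts(2) by (auto simp: br_def)

lemma finite_br: "n \<in> verts T \<Longrightarrow> finite (br n)"
  by (rule finite_subset[OF br_subset finite_verts])

lemma self_in_br: "n \<in> verts T \<Longrightarrow> n \<in> br n"
  by (simp add: br_def)

lemma br_root: "br r = verts T"
  using root_reaches br_subset[OF root_in_verts] by (auto simp: br_def)

lemma parent_in_br: "m \<in> br n \<Longrightarrow> m \<noteq> n \<Longrightarrow> parent T m \<in> br n"
  and br_not_root: "m \<in> br n \<Longrightarrow> m \<noteq> n \<Longrightarrow> m \<noteq> r"
  using parent_reachable by (auto simp: br_def)

lemma descendant_closed_br: "n \<in> verts T \<Longrightarrow> descendant_closed (br n)"
  using br_subset reachable_parentI by (auto simp: descendant_closed_def br_def)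

lemma descendant_closed_verts: "descendant_closed (verts T)"
  by (simp add: descendant_closed_def)

text \<open>Every vertex of the branch other than \<open>n\<close> has exactly one incoming arrow,
  so at \<open>m\<close> the double sum over vertices and arrows has at most one term, which comes
  from the parent of \<open>m\<close>.\<close>

lemma lookup_rep_map_branch:
  assumes n: "n \<in> verts T"
  shows "Poly_Mapping.lookup (rep_map (tm (branch T n)) g x) m =
    (if m \<in> br n \<and> m \<noteq> n \<and> lab m = g then Poly_Mapping.lookup x (parent T m) else 0)"
proof -
  let ?B = "branch T n"
  let ?S = "\<lambda>k. {a \<in> arcs ?B. tail T a = k \<and> snd F a = g}"
  have arcsB: "a \<in> arcs ?B \<and> head T a = m \<longleftrightarrow> m \<in> br n \<and> m \<noteq> n \<and> a = in_arrow T m" for a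
  proof
    assume *: "a \<in> arcs ?B \<and> head T a = m"
    then obtain m' where m': "m' \<in> br n" "m' \<noteq> n" "a = in_arrow T m'"
      by (auto simp: arcs_branch br_def)
    then have "head T a = m'" using head_in_arrow br_subset[OF n] br_not_root[of m' n] by blast
    with m' * show "m \<in> br n \<and> m \<noteq> n \<and> a = in_arrow T m" by simp
  next
    assume *: "m \<in> br n \<and> m \<noteq> n \<and> a = in_arrow T m"
    then have "head T a = m" using head_in_arrow br_subset[OF n] br_not_root[of m n] by blast
    with * show "a \<in> arcs ?B \<and> head T a = m" by (auto simp: arcs_branch br_def)
  qed
  have finS: "finite (?S k)" for k
    using finite_br[OF n] by (auto simp: arcs_branch br_def)
  have inner: "(\<Sum>a\<in>?S k. Poly_Mapping.lookup (basis_vec (head T a) :: 'n \<Rightarrow>\<^sub>0 'k) m) =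
      (if m \<in> br n \<and> m \<noteq> n \<and> lab m = g \<and> parent T m = k then 1 else 0)" for k
  proof -
    have "(\<Sum>a\<in>?S k. Poly_Mapping.lookup (basis_vec (head T a) :: 'n \<Rightarrow>\<^sub>0 'k) m) =
        (\<Sum>a\<in>?S k. if a = in_arrow T m then (if m \<in> br n \<and> m \<noteq> n then 1 else 0) else 0)"
      using arcsB by (intro sum.cong) (auto simp: lookup_single when_def)
    also have "\<dots> = (if in_arrow T m \<in> ?S k then (if m \<in> br n \<and> m \<noteq> n then 1 else 0) else 0)"
      by (simp only: sum.delta[OF finS])
    also have "\<dots> = (if m \<in> br n \<and> m \<noteq> n \<and> lab m = g \<and> parent T m = k then 1 else 0)"
      using arcsB[of "in_arrow T m"] by (auto simp: lab_def parent_def)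
    finally show ?thesis .
  qed
  have "Poly_Mapping.lookup (rep_map (tm ?B) g x) m =
    (\<Sum>k\<in>br n. Poly_Mapping.lookup x k *
      (if m \<in> br n \<and> m \<noteq> n \<and> lab m = g \<and> parent T m = k then 1 else 0))"
    unfolding tm_def tree_module_def quiver_rep.simps inner[symmetric]
    by (simp add: verts_branch tail_branch head_branch lookup_sum br_def)
  also have "\<dots> = (\<Sum>k\<in>br n. if k = parent T m
      then (if m \<in> br n \<and> m \<noteq> n \<and> lab m = g then Poly_Mapping.lookup x k else 0) else 0)"
    by (intro sum.cong) auto
  also have "\<dots> = (if m \<in> br n \<and> m \<noteq> n \<and> lab m = g then Poly_Mapping.lookup x (parent T m) else 0)"
    using parent_in_br[of m n] by (simp add: sum.delta[OF finite_br[OF n]])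
  finally show ?thesis .
qed

lemma lookup_act: "Poly_Mapping.lookup (act g x) m =
    (if m \<in> verts T \<and> m \<noteq> r \<and> lab m = g then Poly_Mapping.lookup x (parent T m) else 0)"
  using lookup_rep_map_branch[OF root_in_verts] by (simp add: act_def branch_root br_root)

text \<open>The two actions could differ only at \<open>n\<close> and outside the branch. There both
  vanish: children of vertices of the branch lie in the branch and, by acyclicity, differ from
  \<open>n\<close>.\<close>

lemma rep_map_branch:
  assumes "n \<in> verts T" "x \<in> supported (br n)"
  shows "rep_map (tm (branch T n)) g x = act g x"
proof (rule poly_mapping_eqI)
  fix m
  have "Poly_Mapping.lookup x (parent T m) = 0" if "m \<in> verts T" "m \<noteq> r" "m \<notin> br n \<or> m = n"
  proof -
    have "parent T m \<notin> br n"
    proof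
      assume p: "parent T m \<in> br n"
      then have "m \<in> br n" using descendant_closed_br[OF assms(1)] that by (auto simp: descendant_closed_def)
      then have "m = n" using that(3) by simp
      moreover have "parent T m \<rightarrow> m" using that by (simp add: dominates_iff)
      ultimately show False
        using p reachable_reachable1_trans not_reachable1_self unfolding br_def by blast
    qed
    then show ?thesis using assms(2) by (simp add: supported_iff)
  qed
  then show "Poly_Mapping.lookup (rep_map (tm (branch T n)) g x) m = Poly_Mapping.lookup (act g x) m"
    using br_subset[OF assms(1)] br_not_root[of m n]
    by (auto simp: lookup_rep_map_branch[OF assms(1)] lookup_act)
qed

lemma module_hom_act: "module_hom pm_scale pm_scale (act g)"
  by unfold_locales (auto intro!: poly_mapping_eqI simp: lookup_add lookup_act)

text \<open>The generators of the path algebra: the arrows, and the trivial paths, which act by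
  \<open>part\<close>. Maps in \<open>homs\<close> therefore respect the components at the vertices
  of \<open>Q\<close>.\<close>

definition operators :: "(('n \<Rightarrow>\<^sub>0 'k) \<Rightarrow> ('n \<Rightarrow>\<^sub>0 'k)) set" where
  "operators = range act \<union> range part"

sublocale operator_module "pm_scale :: 'k \<Rightarrow> ('n \<Rightarrow>\<^sub>0 'k) \<Rightarrow> ('n \<Rightarrow>\<^sub>0 'k)" operators
  by (intro operator_module.intro operator_module_axioms.intro pm.vector_space_axioms)
    (auto simp: operators_def part_def intro: module_hom_act module_hom_restr)

lemma homs_act: "f \<in> homs X Y \<Longrightarrow> x \<in> X \<Longrightarrow> f (act g x) = act g (f x)"
  and homs_part: "f \<in> homs X Y \<Longrightarrow> x \<in> X \<Longrightarrow> f (part q x) = part q (f x)"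
  by (auto intro!: homs_commute simp: operators_def)

lemma act_supported: "descendant_closed Z \<Longrightarrow> x \<in> supported Z \<Longrightarrow> act g x \<in> supported Z"
  by (auto simp: supported_iff lookup_act descendant_closed_def)

lemma part_supported: "x \<in> supported Z \<Longrightarrow> part q x \<in> supported Z"
  by (auto simp: supported_iff part_def)

lemma part_act: "part q (act g x) = (if g \<in> arcs Q \<and> q = head Q g then act g (part (tail Q g) x) else 0)"
  by (rule poly_mapping_eqI) (auto simp: part_def lookup_act col_parent col_head lab_in_arcs)

lemma act_basis_vec:
  "act g (basis_vec k) = (\<Sum>m\<in>{m \<in> verts T - {r}. parent T m = k \<and> lab m = g}. basis_vec m)"
  by (rule poly_mapping_eqI) (auto simp: lookup_act lookup_sum lookup_single when_def)

section \<open>Coefficients of homomorphisms\<close>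

lemma lookup_hom:
  assumes f: "f \<in> homs (supported Z) Y" and "finite Z" "x \<in> supported Z"
  shows "Poly_Mapping.lookup (f x) m =
    (\<Sum>n\<in>Z. Poly_Mapping.lookup x n * Poly_Mapping.lookup (f (basis_vec n)) m)"
proof -
  have "f x = f (\<Sum>n\<in>Z. pm_scale (Poly_Mapping.lookup x n) (basis_vec n))"
    using sum_basis_vec[OF assms(2,3)] by simp
  also have "\<dots> = (\<Sum>n\<in>Z. f (pm_scale (Poly_Mapping.lookup x n) (basis_vec n)))"
    by (intro homs_sum_arg[OF f subspace_supported] pm.subspace_scale[OF subspace_supported]
        basis_vec_in_supported)
  also have "\<dots> = (\<Sum>n\<in>Z. pm_scale (Poly_Mapping.lookup x n) (f (basis_vec n)))"
    by (intro sum.cong refl homs_scale[OF f] basis_vec_in_supported)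
  finally show ?thesis by (simp add: lookup_sum)
qed

text \<open>Compare the coefficients at \<open>y'\<close> in \<open>f (\<gamma> v\<^sub>x) = \<gamma> (f v\<^sub>x)\<close>, where \<open>\<gamma>\<close> labels the arrow into \<open>y'\<close>.\<close>

lemma coefficient_lift:
  assumes f: "f \<in> homs (supported Z) Y" and Z: "descendant_closed Z" and x: "x \<in> Z"
    and y': "y' \<in> verts T" "y' \<noteq> r" and nz: "Poly_Mapping.lookup (f (basis_vec x)) (parent T y') \<noteq> 0"
  obtains x' where "x' \<in> Z" "x' \<in> verts T" "x' \<noteq> r" "parent T x' = x" "lab x' = lab y'"
    "Poly_Mapping.lookup (f (basis_vec x')) y' \<noteq> 0"
proof -
  let ?C = "{m \<in> verts T - {r}. parent T m = x \<and> lab m = lab y'}"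
  have C: "?C \<subseteq> Z" using Z x by (auto simp: descendant_closed_def)
  have "f (act (lab y') (basis_vec x)) = (\<Sum>m\<in>?C. f (basis_vec m))"
    unfolding act_basis_vec using C
    by (intro homs_sum_arg[OF f subspace_supported] basis_vec_in_supported) auto
  moreover have "f (act (lab y') (basis_vec x)) = act (lab y') (f (basis_vec x))"
    by (rule homs_act[OF f basis_vec_in_supported[OF x]])
  moreover have "Poly_Mapping.lookup (act (lab y') (f (basis_vec x))) y' \<noteq> 0"
    using y' nz by (simp add: lookup_act)
  ultimately have "(\<Sum>m\<in>?C. Poly_Mapping.lookup (f (basis_vec m)) y') \<noteq> 0"
    by (simp add: lookup_sum)
  then obtain m where "m \<in> ?C" "Poly_Mapping.lookup (f (basis_vec m)) y' \<noteq> 0"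
    by (meson sum.not_neutral_contains_not_neutral)
  then show thesis using that[of m] C by auto
qed

text \<open>By \<open>coefficient_lift\<close>, a nonzero coefficient at \<open>y\<close> leads to
  one at the child \<open>z\<close> of \<open>y\<close> on the path to \<open>x\<close>, in the
  image of a child \<open>x'\<close> of \<open>x\<close>. Again \<open>z\<close> lies strictly above
  \<open>x'\<close>, so this would continue forever down a finite tree.\<close>

lemma coefficient_ancestor:
  assumes f: "f \<in> homs (supported Z) Y" and Z: "descendant_closed Z" and "x \<in> Z" "y \<rightarrow>\<^sup>+ x"
  shows "Poly_Mapping.lookup (f (basis_vec x)) y = 0"
  using assms(3,4)
proof (induction y arbitrary: x rule: wf_induct_rule[OF wf_arcs_ends_converse])
  case (1 y)
  show ?case
  proof (rule ccontr)
    assume nz: "Poly_Mapping.lookup (f (basis_vec x)) y \<noteq> 0"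
    obtain z where z: "y \<rightarrow>\<^bsub>T\<^esub> z" "(z, x) \<in> (arcs_ends T)\<^sup>*"
      using tranclD[OF 1(3)] by blast
    then have zr: "z \<in> verts T" "z \<noteq> r" "y = parent T z" by (auto simp: dominates_iff)
    obtain x' where x': "x' \<in> Z" "x' \<in> verts T" "x' \<noteq> r" "parent T x' = x"
      "Poly_Mapping.lookup (f (basis_vec x')) z \<noteq> 0"
      by (rule coefficient_lift[OF f Z 1(2) zr(1,2)]) (use nz zr(3) in auto)
    then have "x \<rightarrow>\<^bsub>T\<^esub> x'" by (simp add: dominates_iff)
    with z(2) have "z \<rightarrow>\<^sup>+ x'" by (rule rtrancl_into_trancl1)
    then show False using 1(1)[of z x'] z(1) x' by simp
  qed
qed

text \<open>All other vertices of the branch lie strictly below \<open>n\<close>, so by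
  \<open>coefficient_ancestor\<close> their images contribute nothing at \<open>n\<close>.\<close>

lemma lookup_hom_top:
  assumes "n \<in> verts T" and f: "f \<in> homs (supported (br n)) Y" and x: "x \<in> supported (br n)"
  shows "Poly_Mapping.lookup (f x) n = Poly_Mapping.lookup x n * Poly_Mapping.lookup (f (basis_vec n)) n"
proof -
  have "Poly_Mapping.lookup (f (basis_vec m)) n = 0" if "m \<in> br n - {n}" for m
    using that coefficient_ancestor[OF f descendant_closed_br[OF assms(1)], of m n]
      reachable_neq_reachable1[of n m] by (auto simp: br_def)
  then show ?thesis
    unfolding lookup_hom[OF f finite_br[OF assms(1)] x]
    by (subst sum.remove[OF finite_br[OF assms(1)] self_in_br[OF assms(1)]]) simp
qed

text \<open>The map \<iota> is built from \<open>j\<close> downwards, with the invariant that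
  \<open>m\<close> has a nonzero coefficient in the image of the basis vector at
  \<open>\<iota> m\<close>. Then \<open>coefficient_lift\<close> supplies images for the children of
  \<open>m\<close>.\<close>

lemma ex_morphism:
  assumes f: "f \<in> homs (supported Z) Y" and Z: "descendant_closed Z" and l: "l \<in> Z" and j: "j \<in> verts T"
    and col: "col l = col j" and nz: "Poly_Mapping.lookup (f (basis_vec l)) j \<noteq> 0"
  shows "\<exists>\<iota>. quiver_morphism (branch T j) (branch T l) \<iota> \<and> fst \<iota> j = l \<and>
    (\<forall>m\<in>verts (branch T j). col (fst \<iota> m) = col m) \<and>
    (\<forall>a\<in>arcs (branch T j). snd F (snd \<iota> a) = snd F a)"
proof -
  \<comment> \<open>\<open>P p m x\<close> means that \<open>x\<close> may serve as the image of
    \<open>m\<close> when \<open>p\<close> is the image of the parent of \<open>m\<close>.\<close>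
  define P where "P p m x \<longleftrightarrow> x \<in> Z \<and> x \<in> verts T \<and> x \<noteq> r \<and> parent T x = p \<and> lab x = lab m \<and>
    Poly_Mapping.lookup (f (basis_vec x)) m \<noteq> 0" for p m x
  define G where "G h m = (if m = j then l else SOME x. P (h (parent T m)) m x)" for h m
  define \<iota> where "\<iota> = wfrec (arcs_ends T) G"
  have \<iota>: "\<iota> m = G (cut \<iota> (arcs_ends T) m) m" for m
    unfolding \<iota>_def by (rule wfrec[OF wf_arcs_ends])
  have \<iota>j: "\<iota> j = l" unfolding \<iota>[of j] by (simp add: G_def)
  have "P (\<iota> (parent T y)) y (\<iota> y)"
    if y: "y \<in> verts T" "y \<noteq> r" "y \<noteq> j" and p: "\<iota> (parent T y) \<in> Z"
      "Poly_Mapping.lookup (f (basis_vec (\<iota> (parent T y)))) (parent T y) \<noteq> 0" for y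
  proof -
    have "(parent T y, y) \<in> arcs_ends T" using y by (simp add: dominates_iff)
    then have "cut \<iota> (arcs_ends T) y (parent T y) = \<iota> (parent T y)" by (rule cut_apply)
    then have eq: "\<iota> y = (SOME x. P (\<iota> (parent T y)) y x)"
      unfolding \<iota>[of y] G_def using y(3) by simp
    obtain x where "P (\<iota> (parent T y)) y x"
      unfolding P_def by (rule coefficient_lift[OF f Z p(1) y(1,2) p(2)]) blast
    then show ?thesis unfolding eq by (rule someI)
  qed
  note lift = this[unfolded P_def]
  have inv: "\<iota> m \<in> Z \<and> Poly_Mapping.lookup (f (basis_vec (\<iota> m))) m \<noteq> 0 \<and> \<iota> m \<in> br l \<and> col (\<iota> m) = col m"
    if "j \<rightarrow>\<^sup>* m" for m
    using that
  proof (induction rule: reachable_induct)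
    case base
    then show ?case using \<iota>j l nz col Z self_in_br[of l] by (auto simp: descendant_closed_def)
  next
    case (step x y)
    then have y: "y \<in> verts T" "y \<noteq> r" and x: "x = parent T y" by (auto simp: dominates_iff)
    have "j \<rightarrow>\<^sup>+ y" using reachable_reachable1_trans[OF step(1) r_into_trancl[OF step(2)]] .
    then have yj: "y \<noteq> j" using not_reachable1_self[of j] by auto
    have L: "\<iota> y \<in> Z" "\<iota> y \<in> verts T" "\<iota> y \<noteq> r" "parent T (\<iota> y) = \<iota> x" "lab (\<iota> y) = lab y"
        "Poly_Mapping.lookup (f (basis_vec (\<iota> y))) y \<noteq> 0"
      using lift[OF y yj] step.IH unfolding x by blast+
    have "\<iota> y \<in> br l"
      using reachable_parentI[of l "\<iota> y"] L(2-4) step.IH by (simp add: br_def)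
    then show ?case using L(1,6) col_head[OF L(2,3)] col_head[OF y] L(5) by simp
  qed
  have child: "\<iota> m \<in> br l" "\<iota> m \<noteq> l" "\<iota> m \<in> verts T" "\<iota> m \<noteq> r" "parent T (\<iota> m) = \<iota> (parent T m)"
    "lab (\<iota> m) = lab m" "m \<in> verts T" "m \<noteq> r" if m: "m \<in> br j" "m \<noteq> j" for m
  proof -
    have m': "m \<in> verts T" "m \<noteq> r" using m br_subset[OF j] br_not_root by auto
    have p: "j \<rightarrow>\<^sup>* parent T m" using parent_in_br[OF m] by (simp add: br_def)
    note L = lift[OF m' m(2)] inv[OF p]
    show "\<iota> m \<in> verts T" "\<iota> m \<noteq> r" "parent T (\<iota> m) = \<iota> (parent T m)" "lab (\<iota> m) = lab m"
      "m \<in> verts T" "m \<noteq> r" using L m' by auto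
    show "\<iota> m \<in> br l" using inv[of m] m(1) by (simp add: br_def)
    have "l \<rightarrow>\<^sup>* parent T (\<iota> m)" "parent T (\<iota> m) \<rightarrow> \<iota> m" using L by (auto simp: br_def dominates_iff)
    then have "l \<rightarrow>\<^sup>+ \<iota> m" using reachable_reachable1_trans[OF _ r_into_trancl] by blast
    then show "\<iota> m \<noteq> l" using not_reachable1_self[of l] by auto
  qed
  \<comment> \<open>Compatibility with targets forces this choice on arrows.\<close>
  define \<alpha> where "\<alpha> a = in_arrow T (\<iota> (head T a))" for a
  have arcs: "\<alpha> (in_arrow T m) = in_arrow T (\<iota> m)" if "m \<in> br j - {j}" for m
    using child(7,8)[of m] that by (simp add: \<alpha>_def head_in_arrow)
  show ?thesis
  proof (intro exI[of _ "(\<iota>, \<alpha>)"] conjI)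
    show "quiver_morphism (branch T j) (branch T l) (\<iota>, \<alpha>)"
      unfolding quiver_morphism_def verts_branch arcs_branch tail_branch head_branch fst_conv snd_conv
        br_def[symmetric]
    proof (intro conjI ballI)
      show "\<iota> ` br j \<subseteq> br l" using inv by (auto simp: br_def)
      show "\<alpha> ` in_arrow T ` (br j - {j}) \<subseteq> in_arrow T ` (br l - {l})"
        using arcs child(1,2) by auto
      fix a assume "a \<in> in_arrow T ` (br j - {j})"
      then obtain m where m: "m \<in> br j" "m \<noteq> j" "a = in_arrow T m" by blast
      show "\<iota> (tail T a) = tail T (\<alpha> a)" "\<iota> (head T a) = head T (\<alpha> a)"
        using child[OF m(1,2)] arcs[of m] m by (simp_all add: parent_def head_in_arrow)
    qed
    show "\<forall>m\<in>verts (branch T j). col (fst (\<iota>, \<alpha>) m) = col m"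
      using inv by (simp add: verts_branch)
    show "\<forall>a\<in>arcs (branch T j). snd F (snd (\<iota>, \<alpha>) a) = snd F a"
    proof
      fix a assume "a \<in> arcs (branch T j)"
      then obtain m where m: "m \<in> br j" "m \<noteq> j" "a = in_arrow T m" by (auto simp: arcs_branch br_def)
      then show "snd F (snd (\<iota>, \<alpha>) a) = snd F a"
        using child(6)[OF m(1,2)] arcs[of m] by (simp add: lab_def)
    qed
  qed (simp add: \<iota>j)
qed

section \<open>Decompositions obtained from endomorphisms\<close>

lemma rep_space_branch:
  assumes "n \<in> verts T"
  shows "rep_space (tm (branch T n)) q = {x \<in> supported (br n). part q x = x}"
proof -
  have "part q x = x \<longleftrightarrow> (\<forall>m. col m \<noteq> q \<longrightarrow> Poly_Mapping.lookup x m = 0)" for x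
    by (auto simp: part_def poly_mapping_eq_iff fun_eq_iff)
  then show ?thesis
    unfolding tm_def using finite_br[OF assms]
    by (subst rep_space_tree_module) (auto simp: verts_branch br_def supported_def in_keys_iff)
qed

lemma part_part: "part q (part q' x) = (if q = q' then part q x else 0)"
  by (rule poly_mapping_eqI) (auto simp: part_def)

lemma ex_part_nonzero:
  assumes "x \<in> supported (br n)" "n \<in> verts T" "x \<noteq> 0"
  obtains q where "q \<in> verts Q" "part q x \<noteq> 0"
proof -
  obtain m where m: "Poly_Mapping.lookup x m \<noteq> 0"
    using assms(3) by (metis lookup_zero poly_mapping_eqI)
  then have "m \<in> br n" using assms(1) by (auto simp: supported_iff)
  then have "col m \<in> verts Q" using br_subset[OF assms(2)] col_in_verts by blast
  moreover have "Poly_Mapping.lookup (part (col m) x) m \<noteq> 0" using m by (simp add: part_def)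
  then have "part (col m) x \<noteq> 0" by auto
  ultimately show thesis by (rule that)
qed

text \<open>The hypotheses on \<open>f\<close> say that the module is the direct sum of the image and the kernel of \<open>f\<close>.\<close>

lemma decomposable_branchI:
  assumes n: "n \<in> verts T" and f: "f \<in> homs (supported (br n)) (supported (br n))"
    and im: "\<And>x. x \<in> supported (br n) \<Longrightarrow> \<exists>y\<in>supported (br n). f x = f (f y)"
    and ker: "\<And>x. x \<in> supported (br n) \<Longrightarrow> f (f x) = 0 \<Longrightarrow> f x = 0"
    and x1: "x1 \<in> supported (br n)" "f x1 \<noteq> 0" and x2: "x2 \<in> supported (br n)" "x2 \<noteq> 0" "f x2 = 0"
  shows "decomposable pm_scale Q (tm (branch T n))"
proof -
  let ?X = "supported (br n) :: ('n \<Rightarrow>\<^sub>0 'k) set"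
  define V where "V q = {x \<in> ?X. part q x = x}" for q
  define U where "U q = f ` V q" for q
  define W where "W q = {x \<in> V q. f x = 0}" for q
  have V: "pm.subspace (V q)" for q
    unfolding pm.subspace_def V_def
    by (auto simp: supported_iff part_def poly_mapping_eq_iff fun_eq_iff lookup_add)
  have VX: "x \<in> ?X" if "x \<in> V q" for x q using that by (simp add: V_def)
  have fV: "f x \<in> V q" if "x \<in> V q" for x q
    using that homs_apply[OF f] homs_part[OF f, of x q] by (simp add: V_def)
  have pV: "part q x \<in> V q" if "x \<in> ?X" for x q
    using part_supported[OF that] by (simp add: V_def part_part)
  have aV: "act a x \<in> V (head Q a)" if "a \<in> arcs Q" "x \<in> V (tail Q a)" for a x
    using that act_supported[OF descendant_closed_br[OF n]] by (simp add: V_def part_act)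
  have f0: "f 0 = 0" by (rule homs_zero[OF f subspace_supported])
  have subU: "pm.subspace (U q)" for q
    unfolding pm.subspace_def
  proof (intro conjI ballI allI)
    show "0 \<in> U q" using f0 pm.subspace_0[OF V] by (force simp: U_def)
    fix u v c assume u: "u \<in> U q"
    then obtain x where x: "x \<in> V q" "u = f x" by (auto simp: U_def)
    show "pm_scale c u \<in> U q"
      using homs_scale[OF f VX[OF x(1)], of c] imageI[OF pm.subspace_scale[OF V x(1)], of f c]
      by (simp add: U_def x)
    assume "v \<in> U q"
    then obtain y where y: "y \<in> V q" "v = f y" by (auto simp: U_def)
    show "u + v \<in> U q"
      using homs_add[OF f VX[OF x(1)] VX[OF y(1)]] imageI[OF pm.subspace_add[OF V x(1) y(1)], of f]
      by (simp add: U_def x y)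
  qed
  have subW: "pm.subspace (W q)" for q
    unfolding pm.subspace_def
    using pm.subspace_0[OF V] pm.subspace_add[OF V] pm.subspace_scale[OF V]
    by (auto simp: W_def f0 homs_add[OF f VX VX] homs_scale[OF f VX])
  have UV: "U q \<subseteq> V q" for q using fV by (auto simp: U_def)
  have "subrepresentation pm_scale Q (tm (branch T n)) U"
    unfolding subrepresentation_def rep_space_branch[OF n] V_def[symmetric]
  proof (intro conjI ballI subU UV subsetI)
    fix a y assume a: "a \<in> arcs Q" and "y \<in> rep_map (tm (branch T n)) a ` U (tail Q a)"
    then obtain x where x: "x \<in> V (tail Q a)" "y = rep_map (tm (branch T n)) a (f x)"
      by (auto simp: U_def)
    then have "y = f (act a x)"
      using rep_map_branch[OF n VX[OF fV[OF x(1)]]] homs_act[OF f VX[OF x(1)]] by simp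
    then show "y \<in> U (head Q a)" using aV[OF a x(1)] by (simp add: U_def)
  qed
  moreover have "subrepresentation pm_scale Q (tm (branch T n)) W"
    unfolding subrepresentation_def rep_space_branch[OF n] V_def[symmetric]
  proof (intro conjI ballI subW)
    show "W q \<subseteq> V q" for q by (auto simp: W_def)
    show "rep_map (tm (branch T n)) a ` W (tail Q a) \<subseteq> W (head Q a)" if a: "a \<in> arcs Q" for a
    proof (intro subsetI, elim imageE)
      fix x y assume y: "y = rep_map (tm (branch T n)) a x" and x: "x \<in> W (tail Q a)"
      have "act a 0 = 0" by (rule poly_mapping_eqI) (simp add: lookup_act)
      then show "y \<in> W (head Q a)"
        using x aV[OF a] rep_map_branch[OF n VX] homs_act[OF f VX] unfolding y by (auto simp: W_def)
    qed
  qed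
  moreover have "nonzero_on Q U"
  proof -
    obtain q where q: "q \<in> verts Q" "part q (f x1) \<noteq> 0"
      by (rule ex_part_nonzero[OF homs_apply[OF f x1(1)] n x1(2)])
    have "part q (f x1) \<in> U q"
      using pV[OF x1(1)] homs_part[OF f x1(1), symmetric] by (simp add: U_def)
    with q show ?thesis by (auto simp: nonzero_on_def)
  qed
  moreover have "nonzero_on Q W"
  proof -
    obtain q where q: "q \<in> verts Q" "part q x2 \<noteq> 0" by (rule ex_part_nonzero[OF x2(1) n x2(2)])
    have "part q 0 = 0" by (rule poly_mapping_eqI) (simp add: part_def)
    then have "part q x2 \<in> W q"
      using pV[OF x2(1)] homs_part[OF f x2(1)] x2(3) by (simp add: W_def)
    with q show ?thesis by (auto simp: nonzero_on_def)
  qed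
  moreover have "V q = {u + w |u w. u \<in> U q \<and> w \<in> W q}" for q
  proof (intro equalityI subsetI)
    fix x assume x: "x \<in> V q"
    obtain y where y: "y \<in> ?X" "f x = f (f y)" using im[OF VX[OF x]] by blast
    \<comment> \<open>\<open>y\<close> need not live at the vertex \<open>q\<close>. Since
      \<open>f\<close> commutes with \<open>part q\<close>, its \<open>q\<close>-component still
      satisfies the equation \<open>f x = f (f y)\<close> and yields an element of
      \<open>U q\<close>.\<close>
    let ?u = "f (part q y)"
    have u: "?u \<in> U q" using pV[OF y(1)] by (simp add: U_def)
    have "f ?u = part q (f x)"
      using homs_part[OF f y(1)] homs_part[OF f homs_apply[OF f y(1)]] y(2) by simp
    also have "\<dots> = f x" using fV[OF x] by (simp add: V_def)
    finally have "f (x - ?u) = 0"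
      using homs_diff_arg[OF f subspace_supported VX[OF x] homs_apply[OF f VX[OF pV[OF y(1)]]]] by simp
    then have "x - ?u \<in> W q" using pm.subspace_diff[OF V x] u UV by (auto simp: W_def)
    then show "x \<in> {u + w |u w. u \<in> U q \<and> w \<in> W q}" using u by force
  next
    fix x assume "x \<in> {u + w |u w. u \<in> U q \<and> w \<in> W q}"
    then obtain u w where "x = u + w" "u \<in> V q" "w \<in> V q" using UV by (auto simp: W_def)
    then show "x \<in> V q" using pm.subspace_add[OF V] by simp
  qed
  moreover have "U q \<inter> W q = {0}" for q
    using ker VX pm.subspace_0[OF subU] pm.subspace_0[OF subW] by (fastforce simp: U_def W_def)
  ultimately show ?thesis
    unfolding decomposable_def rep_space_branch[OF n] V_def[symmetric] by blast
qed

section \<open>Decomposability\<close>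

text \<open>The vertexwise summands are assembled into two complementary submodules of the total
  space; \<open>e\<close> is the projection onto one along the other, and it is neither zero nor the
  identity because both are nonzero.\<close>

lemma decomposable_idempotent:
  assumes "decomposable pm_scale Q (tm T)"
  obtains e where "e \<in> homs (supported (verts T)) (supported (verts T))"
    "\<And>x. x \<in> supported (verts T) \<Longrightarrow> e (e x) = e x"
    "\<exists>x\<in>supported (verts T). e x \<noteq> 0" "\<exists>x\<in>supported (verts T). e x \<noteq> x"
proof -
  let ?X = "supported (verts T) :: ('n \<Rightarrow>\<^sub>0 'k) set"
  define V where "V q = {x \<in> ?X. part q x = x}" for q
  have repV: "rep_space (tm T) q = V q" for q
    using rep_space_branch[OF root_in_verts] by (simp add: branch_root br_root V_def)
  have repact: "rep_map (tm T) a x = act a x" for a x by (simp add: act_def)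
  from assms obtain U W where U: "subrepresentation pm_scale Q (tm T) U"
    and W: "subrepresentation pm_scale Q (tm T) W" and nz: "nonzero_on Q U" "nonzero_on Q W"
    and dir: "\<And>q. q \<in> verts Q \<Longrightarrow> V q = {u + w |u w. u \<in> U q \<and> w \<in> W q}"
      "\<And>q. q \<in> verts Q \<Longrightarrow> U q \<inter> W q = {0}"
    unfolding decomposable_def repV by blast
  \<comment> \<open>The direct sum of the spaces \<open>S q\<close>, realised inside the total
    space.\<close>
  define tot where "tot S = {x \<in> ?X. \<forall>q\<in>verts Q. part q x \<in> S q}" for S :: "'v \<Rightarrow> ('n \<Rightarrow>\<^sub>0 'k) set"
  have part_hom: "part q (x + y) = part q x + part q y" "part q (x - y) = part q x - part q y"
      "part q (pm_scale c x) = pm_scale c (part q x)" "part q 0 = 0" for q x y c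
    unfolding part_def
    by (simp_all add: module_hom.add[OF module_hom_restr] module_hom.diff[OF module_hom_restr]
        module_hom.scale[OF module_hom_restr] module_hom.zero[OF module_hom_restr])
  have sub: "pm.subspace (S q)" "S q \<subseteq> V q" "\<And>a x. a \<in> arcs Q \<Longrightarrow> x \<in> S (tail Q a) \<Longrightarrow> act a x \<in> S (head Q a)"
    if "subrepresentation pm_scale Q (tm T) S" "q \<in> verts Q" for S q
    using that unfolding subrepresentation_def repV repact by blast+
  have tot: "pm.subspace (tot S)" "tot S \<subseteq> ?X" "\<And>a x. a \<in> operators \<Longrightarrow> x \<in> tot S \<Longrightarrow> a x \<in> tot S"
    "\<And>q x. q \<in> verts Q \<Longrightarrow> x \<in> S q \<Longrightarrow> x \<in> tot S"
    if S: "subrepresentation pm_scale Q (tm T) S" for S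
  proof -
    note s = sub[OF S]
    have S0: "0 \<in> S q" if "q \<in> verts Q" for q using pm.subspace_0[OF s(1)[OF that]] .
    show "pm.subspace (tot S)"
      unfolding pm.subspace_def tot_def
      using S0 pm.subspace_add[OF s(1)] pm.subspace_scale[OF s(1)]
      by (auto simp: part_hom intro!: pm.subspace_0 pm.subspace_add pm.subspace_scale subspace_supported)
    show "tot S \<subseteq> ?X" by (auto simp: tot_def)
    show "a x \<in> tot S" if a: "a \<in> operators" and x: "x \<in> tot S" for a x
    proof -
      have xX: "x \<in> ?X" and xq: "\<And>q. q \<in> verts Q \<Longrightarrow> part q x \<in> S q" using x by (auto simp: tot_def)
      from a consider g where "a = act g" | q where "a = part q" by (auto simp: operators_def)
      then show ?thesis
      proof cases
        case 1
        have "part q (act g x) \<in> S q" if q: "q \<in> verts Q" for q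
        \<comment> \<open>A nonzero component at the tail of \<open>g\<close> comes from a vertex of
          \<open>T\<close>, which shows that this tail is a vertex of \<open>Q\<close>, as required
          for using the closure of \<open>S\<close> under \<open>g\<close>.\<close>
        proof (cases "g \<in> arcs Q \<and> q = head Q g \<and> part (tail Q g) x \<noteq> 0")
          case True
          obtain m where m: "Poly_Mapping.lookup (part (tail Q g) x) m \<noteq> 0"
            using True by (metis lookup_zero poly_mapping_eqI)
          then have "col m = tail Q g" "m \<in> verts T"
            using xX by (auto simp: part_def supported_iff split: if_splits)
          then have "tail Q g \<in> verts Q" using col_in_verts by metis
          then show ?thesis using True s(3)[OF q] xq by (simp add: part_act)
        next
          case False
          moreover have "act g 0 = 0" by (rule poly_mapping_eqI) (simp add: lookup_act)
          ultimately show ?thesis using S0[OF q] by (auto simp: part_act)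
        qed
        then show ?thesis using act_supported[OF descendant_closed_verts xX] by (simp add: tot_def 1)
      next
        case 2
        then show ?thesis using xq S0 part_supported[OF xX] by (simp add: tot_def part_part)
      qed
    qed
    show "x \<in> tot S" if q: "q \<in> verts Q" and x: "x \<in> S q" for q x
    proof -
      have xV: "x \<in> ?X" "part q x = x" using s(2)[OF q] x by (auto simp: V_def)
      have "part q' x = (if q' = q then x else 0)" for q'
        using part_part[of q' q x] unfolding xV(2) using xV(2) by auto
      then show ?thesis using x xV S0 by (simp add: tot_def)
    qed
  qed
  have sm: "\<exists>u\<in>tot U. x - u \<in> tot W" if x: "x \<in> ?X" for x
  proof -
    let ?C = "col ` verts T"
    have "\<exists>u. u \<in> U q \<and> part q x - u \<in> W q" if q: "q \<in> verts Q" for q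
    proof -
      have "part q x \<in> V q" using part_supported[OF x] by (simp add: V_def part_part)
      then obtain u w where "part q x = u + w" "u \<in> U q" "w \<in> W q" using dir(1)[OF q] by blast
      then show ?thesis by (intro exI[of _ u]) simp
    qed
    then obtain u where u: "\<And>q. q \<in> verts Q \<Longrightarrow> u q \<in> U q \<and> part q x - u q \<in> W q" by metis
    have C: "q \<in> verts Q" if "q \<in> ?C" for q using that col_in_verts by auto
    have x_eq: "x = (\<Sum>q\<in>?C. part q x)"
      using x by (intro poly_mapping_eqI) (auto simp: lookup_sum part_def supported_iff)
    have "(\<Sum>q\<in>?C. u q) \<in> tot U"
      using u C tot(4)[OF U] by (intro pm.subspace_sum[OF tot(1)[OF U]]) blast
    moreover have "(\<Sum>q\<in>?C. part q x - u q) \<in> tot W"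
      using u C tot(4)[OF W] by (intro pm.subspace_sum[OF tot(1)[OF W]]) blast
    then have "x - (\<Sum>q\<in>?C. u q) \<in> tot W" by (simp add: sum_subtractf x_eq[symmetric])
    ultimately show ?thesis by blast
  qed
  have int: "tot U \<inter> tot W = {0}"
  proof -
    have "x = 0" if "x \<in> tot U" "x \<in> tot W" for x
    proof (rule ccontr)
      assume "x \<noteq> 0"
      moreover have "x \<in> supported (br r)" using that by (simp add: tot_def br_root)
      ultimately obtain q where "q \<in> verts Q" "part q x \<noteq> 0"
        using ex_part_nonzero[OF _ root_in_verts] by blast
      then show False using that dir(2) by (auto simp: tot_def)
    qed
    then show ?thesis using pm.subspace_0[OF tot(1)] U W by blast
  qed
  obtain e where e: "e \<in> homs ?X ?X" "\<And>x. x \<in> ?X \<Longrightarrow> e x \<in> tot U"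
    "\<And>u. u \<in> tot U \<Longrightarrow> e u = u" "\<And>w. w \<in> tot W \<Longrightarrow> e w = 0"
    by (rule complement_projection[OF subspace_supported tot(1,2)[OF U] tot(1,2)[OF W] _ _ sm int],
        erule (1) tot(3)[OF U], erule (1) tot(3)[OF W], blast+)
  have ex: "\<exists>x\<in>?X. x \<in> tot S \<and> x \<noteq> 0"
    if S: "subrepresentation pm_scale Q (tm T) S" and nz: "nonzero_on Q S" for S
  proof -
    from nz obtain q where q: "q \<in> verts Q" "S q \<noteq> {0}" by (auto simp: nonzero_on_def)
    then obtain x where "x \<in> S q" "x \<noteq> 0" using pm.subspace_0[OF sub(1)[OF S q(1)]] by blast
    then show ?thesis using tot(2,4)[OF S] q(1) by blast
  qed
  show thesis
  proof (rule that[OF e(1)])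
    show "e (e x) = e x" if "x \<in> ?X" for x using e(2,3) that by simp
    show "\<exists>x\<in>?X. e x \<noteq> 0" using ex[OF U nz(1)] e(3) by metis
    show "\<exists>x\<in>?X. e x \<noteq> x" using ex[OF W nz(2)] e(4) by metis
  qed
qed

section \<open>Branches at the children of the root\<close>

abbreviation (input) morphism_of_branches :: "'n \<Rightarrow> 'n \<Rightarrow> bool" where
  "morphism_of_branches i j \<equiv> \<exists>\<iota>. quiver_morphism (branch T i) (branch T j) \<iota> \<and> fst \<iota> i = j \<and>
    (\<forall>m\<in>verts (branch T i). col (fst \<iota> m) = col m) \<and>
    (\<forall>a\<in>arcs (branch T i). snd F (snd \<iota> a) = snd F a)"

definition root_children :: "'n set" where
  "root_children = {n \<in> verts T - {r}. parent T n = r}"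

lemma root_childrenD:
  assumes "n \<in> root_children" shows "n \<in> verts T" "n \<noteq> r" "parent T n = r" "r \<notin> br n"
  using assms not_reaches_root[of n] by (auto simp: root_children_def br_def)

lemma root_child_of_nonroot:
  assumes "m \<in> verts T" "m \<noteq> r"
  obtains n where "n \<in> root_children" "m \<in> br n" "\<And>n'. n' \<in> root_children \<Longrightarrow> m \<in> br n' \<Longrightarrow> n' = n"
proof -
  obtain n where n: "n \<in> verts T" "n \<noteq> r" "parent T n = r" "n \<rightarrow>\<^sup>* m" by (rule child_reaches[OF assms])
  show thesis
  proof (rule that[of n])
    show "n \<in> root_children" "m \<in> br n" using n by (auto simp: root_children_def br_def)
    fix n' assume "n' \<in> root_children" "m \<in> br n'"
    then show "n' = n"
      using child_reaches_unique[OF _ _ _ n(2,3,4), of n'] by (auto simp: root_children_def br_def)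
  qed
qed

lemma decomposable_if_morphism_of_branches:
  assumes i: "i \<in> root_children" and j: "j \<in> root_children" and ij: "i \<noteq> j" and lab: "lab i = lab j"
    and mor: "morphism_of_branches i j"
  shows "decomposable pm_scale Q (tm T)"
proof -
  from mor obtain \<iota> \<alpha> where hom: "quiver_morphism (branch T i) (branch T j) (\<iota>, \<alpha>)" and \<iota>i: "\<iota> i = j"
    and col\<iota>: "\<And>m. m \<in> br i \<Longrightarrow> col (\<iota> m) = col m"
    and lab\<alpha>: "\<And>a. a \<in> arcs (branch T i) \<Longrightarrow> snd F (\<alpha> a) = snd F a"
    by (auto simp: verts_branch br_def)
  note iT = root_childrenD[OF i] and jT = root_childrenD[OF j]
  have \<iota>br: "\<iota> m \<in> br j" if "m \<in> br i" for m
    using hom that by (auto simp: quiver_morphism_def verts_branch br_def)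
  have \<iota>: "\<iota> m \<in> verts T" "\<iota> m \<noteq> r" "lab (\<iota> m) = lab m" "parent T (\<iota> m) = \<iota> (parent T m)"
    if m: "m \<in> br i" "m \<noteq> i" for m
  proof -
    have mT: "m \<in> verts T" "m \<noteq> r" using m br_subset[OF iT(1)] br_not_root by auto
    have a: "in_arrow T m \<in> arcs (branch T i)" using m by (simp add: arcs_branch br_def)
    then have \<alpha>: "\<alpha> (in_arrow T m) \<in> arcs (branch T j)"
      and ht: "\<iota> (parent T m) = tail T (\<alpha> (in_arrow T m))" "\<iota> m = head T (\<alpha> (in_arrow T m))"
      using hom mT by (auto simp: quiver_morphism_def tail_branch head_branch parent_def head_in_arrow)
    from \<alpha> obtain m' where m': "m' \<in> br j" "m' \<noteq> j" "\<alpha> (in_arrow T m) = in_arrow T m'"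
      by (auto simp: arcs_branch br_def)
    have m'T: "m' \<in> verts T" "m' \<noteq> r" using m' br_subset[OF jT(1)] br_not_root by auto
    have "\<iota> m = m'" using ht(2) m'(3) m'T by (simp add: head_in_arrow)
    then show "\<iota> m \<in> verts T" "\<iota> m \<noteq> r" "lab (\<iota> m) = lab m" "parent T (\<iota> m) = \<iota> (parent T m)"
      using m'T m'(3) ht(1) lab\<alpha>[OF a] by (simp_all add: lab_def parent_def)
  qed
  let ?X = "supported (verts T) :: ('n \<Rightarrow>\<^sub>0 'k) set"
  \<comment> \<open>For \<open>k \<in> br i\<close> the basis vector at \<open>k\<close> is fixed;
    for \<open>k \<in> br j\<close> it goes to minus the sum of the basis vectors at the
    \<open>m \<in> br i\<close> with \<open>\<iota> m = k\<close>.\<close>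
  define e :: "('n \<Rightarrow>\<^sub>0 'k) \<Rightarrow> ('n \<Rightarrow>\<^sub>0 'k)" where
    "e x = (\<Sum>m\<in>br i. Poly_Mapping.single m (Poly_Mapping.lookup x m - Poly_Mapping.lookup x (\<iota> m)))" for x
  have e: "Poly_Mapping.lookup (e x) m =
      (if m \<in> br i then Poly_Mapping.lookup x m - Poly_Mapping.lookup x (\<iota> m) else 0)" for x m
    using finite_br[OF iT(1)] by (auto simp: e_def lookup_sum lookup_single when_def)
  have notbr: "m \<notin> br i" if "m \<in> br j" for m
    using that ij i j iT(1) root_child_of_nonroot[of m] br_subset[OF jT(1)] jT(4) by (metis subsetD)
  \<comment> \<open>The coefficients of \<open>e x\<close> vanish on \<open>br j\<close>, which is
    disjoint from \<open>br i\<close>, so nothing is subtracted in the second application.\<close>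
  have idem: "e (e x) = e x" for x
    by (rule poly_mapping_eqI) (auto simp: e dest: \<iota>br notbr)
  have "e \<in> homs ?X ?X"
  proof (rule homsI)
    fix x :: "'n \<Rightarrow>\<^sub>0 'k"
    show "e x \<in> ?X" using br_subset[OF iT(1)] by (auto simp: supported_iff e)
    show "e (x + y) = e x + e y" for y by (rule poly_mapping_eqI) (simp add: e lookup_add)
    show "e (pm_scale c x) = pm_scale c (e x)" for c
      by (rule poly_mapping_eqI) (simp add: e algebra_simps)
    have "e (act g x) = act g (e x)" for g
    proof (rule poly_mapping_eqI)
      fix m
      consider "m = i" | "m \<in> br i" "m \<noteq> i" | "m \<notin> br i" by blast
      then show "Poly_Mapping.lookup (e (act g x)) m = Poly_Mapping.lookup (act g (e x)) m"
      proof cases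
        \<comment> \<open>On the left, the arrows from the root into \<open>i\<close> and
          \<open>j\<close> carry the same label, so two equal coefficients cancel. On the right,
          \<open>e x\<close> has coefficient zero at the root.\<close>
        case 1
        then show ?thesis
          using iT jT self_in_br[OF iT(1)] lab by (simp add: e lookup_act \<iota>i)
      next
        case 2
        then have "m \<in> verts T" "m \<noteq> r" using br_subset[OF iT(1)] br_not_root by auto
        then show ?thesis using 2 \<iota>[OF 2] parent_in_br[OF 2] by (simp add: e lookup_act)
      next
        case 3
        then have "parent T m \<notin> br i" if "m \<in> verts T" "m \<noteq> r"
          using descendant_closed_br[OF iT(1)] that by (auto simp: descendant_closed_def)
        then show ?thesis using 3 by (simp add: e lookup_act)
      qed
    qed
    moreover have "e (part q x) = part q (e x)" for q
      by (rule poly_mapping_eqI) (auto simp: e part_def col\<iota>)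
    ultimately show "e (a x) = a (e x)" if "a \<in> operators" for a
      using that by (auto simp: operators_def)
  qed
  \<comment> \<open>The vectors \<open>basis_vec i\<close> and \<open>basis_vec r\<close> show that
    image and kernel of \<open>e\<close> are both nonzero.\<close>
  moreover have "e (basis_vec i) \<noteq> 0"
  proof -
    have "Poly_Mapping.lookup (e (basis_vec i)) i = 1"
      using ij self_in_br[OF iT(1)] by (simp add: e \<iota>i lookup_single when_def)
    then show ?thesis by auto
  qed
  moreover have "e (basis_vec r) = 0"
  proof (rule poly_mapping_eqI)
    have "m \<noteq> r" "\<iota> m \<noteq> r" if "m \<in> br i" for m using that iT(4) jT(4) \<iota>br by auto
    then show "Poly_Mapping.lookup (e (basis_vec r)) m = Poly_Mapping.lookup 0 m" for m
      by (auto simp: e lookup_single when_def)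
  qed
  moreover have "(basis_vec r :: 'n \<Rightarrow>\<^sub>0 'k) \<noteq> 0"
    by (metis lookup_single_eq lookup_zero zero_neq_one)
  ultimately show ?thesis
    using decomposable_branchI[OF root_in_verts, of e "basis_vec i" "basis_vec r"] idem
    unfolding br_root branch_root
    by (metis basis_vec_in_supported iT(1) root_in_verts)
qed

lemma morphism_of_branches_if_decomposable:
  assumes dec: "decomposable pm_scale Q (tm T)"
    and ind: "\<And>j. j \<in> root_children \<Longrightarrow> \<not> decomposable pm_scale Q (tm (branch T j))"
  shows "\<exists>i\<in>root_children. \<exists>j\<in>root_children. i \<noteq> j \<and> lab i = lab j \<and> morphism_of_branches i j"
proof (rule ccontr)
  assume no: "\<not> ?thesis"
  let ?X = "supported (verts T) :: ('n \<Rightarrow>\<^sub>0 'k) set"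
  let ?X' = "supported (verts T - {r}) :: ('n \<Rightarrow>\<^sub>0 'k) set"
  have X'X: "?X' \<subseteq> ?X" by (rule supported_mono) blast
  have top: "Poly_Mapping.lookup (f x) r = Poly_Mapping.lookup x r * Poly_Mapping.lookup (f (basis_vec r)) r"
    if "f \<in> homs ?X ?X" "x \<in> ?X" for f x
    using lookup_hom_top[OF root_in_verts, unfolded br_root] that .
  obtain e0 where e0: "e0 \<in> homs ?X ?X" "\<And>x. x \<in> ?X \<Longrightarrow> e0 (e0 x) = e0 x"
    "\<exists>x\<in>?X. e0 x \<noteq> 0" "\<exists>x\<in>?X. e0 x \<noteq> x"
    using decomposable_idempotent[OF dec] by blast
  \<comment> \<open>By \<open>top\<close>, taking the coefficient at the root is multiplicative on
    endomorphisms, so \<open>c\<close> is an idempotent of the field.\<close>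
  define c where "c = Poly_Mapping.lookup (e0 (basis_vec r)) r"
  have br: "basis_vec r \<in> ?X" by (rule basis_vec_in_supported[OF root_in_verts])
  have "c = c * c" using top[OF e0(1) homs_apply[OF e0(1) br]] e0(2)[OF br] by (simp add: c_def)
  then have c: "c = 0 \<or> c = 1" by simp
  \<comment> \<open>If \<open>c = 1\<close>, the complementary idempotent \<open>1 - e0\<close> is
    taken; it is nonzero since \<open>e0\<close> is not the identity. In either case the image
    avoids the root.\<close>
  obtain e where e: "e \<in> homs ?X ?X" "\<And>x. x \<in> ?X \<Longrightarrow> e (e x) = e x" "\<exists>x\<in>?X. e x \<noteq> 0"
    "Poly_Mapping.lookup (e (basis_vec r)) r = 0"
  proof (cases "c = 0")
    case True
    then show thesis using that[OF e0(1-3)] by (simp add: c_def)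
  next
    case False
    let ?e = "\<lambda>x. x - e0 x"
    show thesis
    proof (rule that[of ?e])
      show "?e \<in> homs ?X ?X"
        using homs_diff[OF subspace_supported homs_id e0(1)] by simp
      show "?e (?e x) = ?e x" if "x \<in> ?X" for x
        using homs_diff_arg[OF e0(1) subspace_supported that homs_apply[OF e0(1) that]] e0(2)[OF that] by simp
      show "\<exists>x\<in>?X. ?e x \<noteq> 0" using e0(4) by force
      show "Poly_Mapping.lookup (?e (basis_vec r)) r = 0"
        using False c by (simp add: lookup_minus c_def)
    qed
  qed
  have eX': "e x \<in> ?X'" if "x \<in> ?X" for x
    using top[OF e(1) that] e(4) homs_apply[OF e(1) that] by (auto simp: supported_iff)
  then have eXX': "e \<in> homs ?X ?X'" using e(1) by (auto simp: homs_def)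
  \<comment> \<open>Compare the coefficients at \<open>j\<close> in
    \<open>f (\<gamma> v_r) = \<gamma> (f v_r)\<close>, where \<gamma> is the label of
    \<open>j\<close>. The right side gives zero. On the left, a nonzero contribution of another
    child \<open>m\<close> with this label would yield a morphism from the branch of
    \<open>j\<close> to that of \<open>m\<close>, so the contribution of \<open>j\<close> is zero
    too.\<close>
  have top0: "Poly_Mapping.lookup (f (basis_vec j)) j = 0"
    if f: "f \<in> homs ?X ?X'" and j: "j \<in> root_children" for f j
  proof -
    note jT = root_childrenD[OF j]
    let ?C = "{m \<in> verts T - {r}. parent T m = r \<and> lab m = lab j}"
    have jC: "j \<in> ?C" using jT by simp
    have f1: "f (act (lab j) (basis_vec r)) = (\<Sum>m\<in>?C. f (basis_vec m))"
      unfolding act_basis_vec by (intro homs_sum_arg[OF f subspace_supported] basis_vec_in_supported) auto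
    have f2: "f (act (lab j) (basis_vec r)) = act (lab j) (f (basis_vec r))"
      by (rule homs_act[OF f br])
    have "Poly_Mapping.lookup (act (lab j) (f (basis_vec r))) j = 0"
      using homs_apply[OF f br] jT by (simp add: lookup_act supported_iff)
    then have "(\<Sum>m\<in>?C. Poly_Mapping.lookup (f (basis_vec m)) j) = 0"
      unfolding f2[symmetric] f1 lookup_sum .
    moreover have "Poly_Mapping.lookup (f (basis_vec m)) j = 0" if m: "m \<in> ?C - {j}" for m
    proof (rule ccontr)
      assume nz: "Poly_Mapping.lookup (f (basis_vec m)) j \<noteq> 0"
      have "m \<in> verts T" "m \<noteq> r" using m by auto
      then have "col m = col j" using m col_head[of m] col_head[OF jT(1,2)] by simp
      then have "morphism_of_branches j m"
        using ex_morphism[OF f descendant_closed_verts _ jT(1) _ nz] m by simp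
      moreover have "m \<in> root_children" using m by (simp add: root_children_def)
      moreover have "lab j = lab m" "j \<noteq> m" using m by auto
      ultimately show False using no j by blast
    qed
    ultimately show ?thesis by (subst (asm) sum.remove[OF _ jC]) auto
  qed
  \<comment> \<open>Projections onto the summands \<open>M_j\<close>. They commute with the arrows
    only on \<open>?X'\<close>: an arrow out of the root leads into \<open>br j\<close> from
    outside.\<close>
  let ?p = "\<lambda>j. restr (br j) :: ('n \<Rightarrow>\<^sub>0 'k) \<Rightarrow> _"
  have p: "?p j \<in> homs ?X' (supported (br j))" if j: "j \<in> root_children" for j
  proof (rule homsI)
    note jT = root_childrenD[OF j]
    fix x assume x: "x \<in> ?X'"
    show "?p j x \<in> supported (br j)" by (simp add: supported_iff)
    show "?p j (x + y) = ?p j x + ?p j y" for y by (rule module_hom.add[OF module_hom_restr])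
    show "?p j (pm_scale c x) = pm_scale c (?p j x)" for c by (rule module_hom.scale[OF module_hom_restr])
    have "?p j (act g x) = act g (?p j x)" for g
    proof (rule poly_mapping_eqI)
      fix m
      consider "m = j" | "m \<in> br j" "m \<noteq> j" | "m \<notin> br j" by blast
      then show "Poly_Mapping.lookup (?p j (act g x)) m = Poly_Mapping.lookup (act g (?p j x)) m"
      proof cases
        case 1
        then show ?thesis using jT x by (simp add: lookup_act supported_iff)
      next
        case 2
        then show ?thesis using parent_in_br[OF 2] by (simp add: lookup_act)
      next
        case 3
        then have "parent T m \<notin> br j" if "m \<in> verts T" "m \<noteq> r"
          using descendant_closed_br[OF jT(1)] that by (auto simp: descendant_closed_def)
        then show ?thesis using 3 by (simp add: lookup_act)
      qed
    qed
    moreover have "?p j (part q x) = part q (?p j x)" for q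
      by (rule poly_mapping_eqI) (simp add: part_def)
    ultimately show "?p j (a x) = a (?p j x)" if "a \<in> operators" for a
      using that by (auto simp: operators_def)
  qed
  have brX': "supported (br j) \<subseteq> ?X'" if "j \<in> root_children" for j
    using root_childrenD[OF that] br_subset[of j] by (intro supported_mono) auto
  have "e x = 0" if "x \<in> ?X'" for x
  proof (rule idempotent_eq_0[where J = root_children and p = ?p and e = e, OF subspace_supported _ _ _ _ _ _ that])
    show "finite root_children" by (simp add: root_children_def)
    show "e \<in> homs ?X' ?X'" by (rule homs_mono[OF eXX' X'X order_refl])
    show "e (e x) = e x" if "x \<in> ?X'" for x using e(2) that X'X by blast
    show "?p j \<in> homs ?X' ?X'" if "j \<in> root_children" for j
      by (rule homs_mono[OF p[OF that] order_refl brX'[OF that]])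
    show "(\<Sum>j\<in>root_children. ?p j x) = x" if x: "x \<in> ?X'" for x
    proof (rule poly_mapping_eqI)
      fix m
      show "Poly_Mapping.lookup (\<Sum>j\<in>root_children. ?p j x) m = Poly_Mapping.lookup x m"
      proof (cases "m \<in> verts T \<and> m \<noteq> r")
        case True
        then obtain n where n: "n \<in> root_children" "m \<in> br n" "\<And>n'. n' \<in> root_children \<Longrightarrow> m \<in> br n' \<Longrightarrow> n' = n"
          using root_child_of_nonroot[of m] by blast
        have "m \<in> br j \<longleftrightarrow> j = n" if "j \<in> root_children" for j
          using n that by blast
        then have "(\<Sum>j\<in>root_children. Poly_Mapping.lookup (?p j x) m) =
            (\<Sum>j\<in>root_children. if j = n then Poly_Mapping.lookup x m else 0)"
          by (intro sum.cong) simp_all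
        also have "\<dots> = Poly_Mapping.lookup x m"
          using n(1) by (simp add: root_children_def)
        finally show ?thesis by (simp only: lookup_sum)
      next
        case False
        then have "Poly_Mapping.lookup x m = 0" using x by (auto simp: supported_iff)
        then show ?thesis by (auto simp: lookup_sum intro!: sum.neutral)
      qed
    qed
    show "\<exists>n. \<forall>x\<in>?X'. ((h \<circ> e \<circ> ?p j) ^^ n) x = 0" if j: "j \<in> root_children" and h: "h \<in> homs ?X' ?X'" for j h
    proof -
      note jT = root_childrenD[OF j]
      let ?Y = "supported (br j) :: ('n \<Rightarrow>\<^sub>0 'k) set"
      have he: "h \<circ> e \<in> homs ?X ?X'" by (rule homs_comp[OF eXX' h])
      \<comment> \<open>The diagonal block of \<open>h \<circ> e\<close> at
        \<open>M_j\<close>.\<close>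
      define k where "k = ?p j \<circ> (h \<circ> e)"
      have YX: "?Y \<subseteq> ?X" using brX'[OF j] X'X by blast
      have k: "k \<in> homs ?Y ?Y" unfolding k_def
        by (rule homs_mono[OF homs_comp[OF he p[OF j]] YX order_refl])
      have kj: "Poly_Mapping.lookup (k x) j = 0" if "x \<in> ?Y" for x
        using lookup_hom_top[OF jT(1) k that] top0[OF he j] by (simp add: k_def)
      obtain n where n: "0 < n" "\<And>x. x \<in> ?Y \<Longrightarrow> \<exists>y\<in>?Y. (k ^^ n) x = (k ^^ n) ((k ^^ n) y)"
        "\<And>x. x \<in> ?Y \<Longrightarrow> (k ^^ n) ((k ^^ n) x) = 0 \<Longrightarrow> (k ^^ n) x = 0"
        by (rule fitting[OF subspace_supported supported_subset_span[OF finite_br[OF jT(1)]]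
              finite_imageI[OF finite_br[OF jT(1)]] k]) blast
      note kn = homs_funpow[OF k, of n]
      \<comment> \<open>Otherwise image and kernel of \<open>k ^^ n\<close> would both be nonzero
        and would decompose the indecomposable module \<open>M_j\<close>.\<close>
      have "(k ^^ n) x = 0" if "x \<in> ?Y" for x
      proof (rule ccontr)
        assume nz: "(k ^^ n) x \<noteq> 0"
        have bj: "basis_vec j \<in> ?Y" by (rule basis_vec_in_supported[OF self_in_br[OF jT(1)]])
        then obtain y where y: "y \<in> ?Y" "(k ^^ n) (basis_vec j) = (k ^^ n) ((k ^^ n) y)" using n(2) by blast
        \<comment> \<open>This is the kernel component of the basis vector at \<open>j\<close>. It
          is nonzero because that vector does not occur in the image of \<open>k ^^ n\<close>; here
          \<open>0 < n\<close> matters.\<close>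
        let ?z = "basis_vec j - (k ^^ n) y"
        have ky: "(k ^^ n) y \<in> ?Y" by (rule homs_apply[OF kn y(1)])
        have z: "?z \<in> ?Y" by (rule pm.subspace_diff[OF subspace_supported bj ky])
        have kz: "(k ^^ n) ?z = 0"
          using homs_diff_arg[OF kn subspace_supported bj ky] y(2) by simp
        obtain n' where n': "n = Suc n'" using n(1) by (cases n) auto
        have "Poly_Mapping.lookup ((k ^^ n) y) j = 0"
          unfolding n' using kj[OF homs_apply[OF homs_funpow[OF k] y(1)]] by simp
        then have "Poly_Mapping.lookup ?z j = 1" by (simp add: lookup_minus)
        then have z0: "?z \<noteq> 0" by auto
        have "decomposable pm_scale Q (tm (branch T j))"
          by (rule decomposable_branchI[OF jT(1) kn n(2,3) that nz z z0 kz])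
        then show False using ind[OF j] by simp
      qed
      then have "(h \<circ> e) ((k ^^ n) (?p j x)) = 0" if "x \<in> ?X'" for x
        using homs_apply[OF p[OF j] that] homs_zero[OF he subspace_supported] by simp
      \<comment> \<open>Reversing the order of the factors \<open>h \<circ> e\<close> and
        \<open>?p j\<close> costs one additional power.\<close>
      moreover have "((h \<circ> e \<circ> ?p j) ^^ Suc i) x = (h \<circ> e) ((k ^^ i) (?p j x))" for i x
        by (induction i) (simp_all add: k_def)
      ultimately have "((h \<circ> e \<circ> ?p j) ^^ Suc n) x = 0" if "x \<in> ?X'" for x
        using that by simp
      then show ?thesis by blast
    qed
  qed
  \<comment> \<open>\<open>e\<close> maps into \<open>?X'\<close>, where it vanishes; being
    idempotent, it vanishes everywhere.\<close>
  moreover obtain x where "x \<in> ?X" "e x \<noteq> 0" using e(3) by blast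
  ultimately show False using e(2) eX' by metis
qed

end

section \<open>Passage between children of the root and indices of the list\<close>

theorem corollary4p8:
  fixes Q :: "('v, 'e) pre_digraph" and \<rho> :: "('v, 'e) qpath set"
    and T :: "('n, 'b) pre_digraph" and F :: "('n, 'b, 'v, 'e) quiver_map"
    and root :: 'n and ns :: "'n list"
  assumes "CHAR('k::field) \<noteq> 2"
    and "bound_quiver TYPE('k) Q \<rho>"
    and "rooted_tree T root"
    and "bound_morphism TYPE('k) T Q \<rho> F"
    and "distinct ns"
    and "set ns = {n \<in> verts T - {root}. parent T n = root}"
    and "\<forall>j<length ns. indecomposable pm_scale Q
      (tree_module (branch T (ns ! j)) F :: ('v, 'e, 'n \<Rightarrow>\<^sub>0 'k) quiver_rep)"
  shows "decomposable pm_scale Q (tree_module T F :: ('v, 'e, 'n \<Rightarrow>\<^sub>0 'k) quiver_rep) \<longleftrightarrow>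
    (\<exists>i<length ns. \<exists>j<length ns. i \<noteq> j \<and>
      snd F (in_arrow T (ns ! i)) = snd F (in_arrow T (ns ! j)) \<and>
      (\<exists>\<iota>. quiver_morphism (branch T (ns ! i)) (branch T (ns ! j)) \<iota> \<and>
        fst \<iota> (ns ! i) = ns ! j \<and>
        (\<forall>m\<in>verts (branch T (ns ! i)). fst F (fst \<iota> m) = fst F m) \<and>
        (\<forall>a\<in>arcs (branch T (ns ! i)). snd F (snd \<iota> a) = snd F a)))"
proof -
  interpret fin_digraph T using assms(3) by (simp add: rooted_tree_def tree_quiver_def)
  interpret tree_over T root Q F "TYPE('k)"
    by unfold_locales (use assms(3,4) in \<open>simp_all add: bound_morphism_def\<close>)
  have ns: "set ns = root_children" using assms(6) by (simp add: root_children_def)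
  show ?thesis (is "?dec \<longleftrightarrow> ?mor")
  proof
    assume dec: ?dec
    have "\<not> decomposable pm_scale Q (tm (branch T j))" if "j \<in> root_children" for j
      using assms(7) that unfolding ns[symmetric] tm_def indecomposable_def in_set_conv_nth by blast
    then obtain a b where ab: "a \<in> root_children" "b \<in> root_children" "a \<noteq> b" "lab a = lab b"
        "morphism_of_branches a b"
      using morphism_of_branches_if_decomposable[unfolded tm_def, OF dec] unfolding tm_def by blast
    obtain i where i: "i < length ns" "ns ! i = a"
      using ab(1) unfolding ns[symmetric] in_set_conv_nth by blast
    obtain j where j: "j < length ns" "ns ! j = b"
      using ab(2) unfolding ns[symmetric] in_set_conv_nth by blast
    show ?mor
    proof (rule exI[of _ i], intro conjI i(1), rule exI[of _ j], intro conjI j(1))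
      show "i \<noteq> j" using ab(3) i(2) j(2) by blast
      show "snd F (in_arrow T (ns ! i)) = snd F (in_arrow T (ns ! j))"
        using ab(4) unfolding i(2) j(2) lab_def .
      show "morphism_of_branches (ns ! i) (ns ! j)" using ab(5) unfolding i(2) j(2) .
    qed
  next
    assume ?mor
    then obtain i j where ij: "i < length ns" "j < length ns" "i \<noteq> j" "lab (ns ! i) = lab (ns ! j)"
        "morphism_of_branches (ns ! i) (ns ! j)"
      unfolding lab_def by blast
    \<comment> \<open>Distinctness of \<open>ns\<close> turns different indices into different
      vertices.\<close>
    then have "ns ! i \<in> root_children" "ns ! j \<in> root_children" "ns ! i \<noteq> ns ! j"
      using assms(5) by (simp_all add: ns[symmetric] nth_eq_iff_index_eq)
    from decomposable_if_morphism_of_branches[OF this ij(4,5)] show ?dec by (simp add: tm_def)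
  qed
qed

end
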